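(* The Lie algebra $\mathfrak{psl}_3(\mathbb{F}_3)$ is taut.
   Context: $\mathfrak{psl}_3(\mathbb{F}_3)$ is the $7$-dimensional Lie algebra over the field $\mathbb{F}_3$ with three elements obtained as the quotient of $\mathfrak{sl}_3(\mathbb{F}_3)$ (trace-zero $3\times3$ matrices over $\mathbb{F}_3$ with the commutator bracket) by its center, which is spanned by the identity matrix. For a Lie algebra $\mathfrak{g}$, $\mathrm{Der}(\mathfrak{g})$ is the Lie algebra of derivations and $\mathrm{Inn}(\mathfrak{g})$ the ideal of inner derivations. $\mathfrak{g}$ is called taut if every Lie algebra homomorphism $\varphi\colon\mathfrak{g}\to\mathrm{Der}(\mathfrak{g})$ satisfies $\varphi(\mathfrak{g})\subseteq\mathrm{Inn}(\mathfrak{g})$. *)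

theory Defs
  imports "HOL-Analysis.Determinants" "HOL-Library.Function_Algebras"
begin

text \<open>A Lie algebra is a subspace \<open>L\<close> of an ambient vector space, with a bracket on \<open>L\<close>.\<close>

locale lie_algebra = vector_space scl
  for scl :: "'k::field \<Rightarrow> 'a::ab_group_add \<Rightarrow> 'a" +
  fixes L :: "'a set" and br :: "'a \<Rightarrow> 'a \<Rightarrow> 'a"
  assumes subspace_carrier: "subspace L"
    and br_closed: "\<lbrakk>x \<in> L; y \<in> L\<rbrakk> \<Longrightarrow> br x y \<in> L"
    and br_add_left: "\<lbrakk>x \<in> L; y \<in> L; z \<in> L\<rbrakk> \<Longrightarrow> br (x + y) z = br x z + br y z"
    and br_add_right: "\<lbrakk>x \<in> L; y \<in> L; z \<in> L\<rbrakk> \<Longrightarrow> br x (y + z) = br x y + br x z"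
    and br_scale_left: "\<lbrakk>x \<in> L; y \<in> L\<rbrakk> \<Longrightarrow> br (scl c x) y = scl c (br x y)"
    and br_scale_right: "\<lbrakk>x \<in> L; y \<in> L\<rbrakk> \<Longrightarrow> br x (scl c y) = scl c (br x y)"
    and br_self: "x \<in> L \<Longrightarrow> br x x = 0"
    and br_jacobi: "\<lbrakk>x \<in> L; y \<in> L; z \<in> L\<rbrakk> \<Longrightarrow>
      br x (br y z) + br y (br z x) + br z (br x y) = 0"

definition lie_center :: "'a::ab_group_add set \<Rightarrow> ('a \<Rightarrow> 'a \<Rightarrow> 'a) \<Rightarrow> 'a set" where
  "lie_center L br = {z \<in> L. \<forall>x\<in>L. br z x = 0}"

definition lie_hom ::
  "('k \<Rightarrow> 'a::ab_group_add \<Rightarrow> 'a) \<Rightarrow> 'a set \<Rightarrow> ('a \<Rightarrow> 'a \<Rightarrow> 'a) \<Rightarrow>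
   ('k \<Rightarrow> 'b::ab_group_add \<Rightarrow> 'b) \<Rightarrow> 'b set \<Rightarrow> ('b \<Rightarrow> 'b \<Rightarrow> 'b) \<Rightarrow> ('a \<Rightarrow> 'b) \<Rightarrow> bool" where
  "lie_hom scl L br scl' L' br' \<phi> \<longleftrightarrow>
     \<phi> ` L \<subseteq> L' \<and>
     (\<forall>x\<in>L. \<forall>y\<in>L. \<phi> (x + y) = \<phi> x + \<phi> y) \<and>
     (\<forall>c. \<forall>x\<in>L. \<phi> (scl c x) = scl' c (\<phi> x)) \<and>
     (\<forall>x\<in>L. \<forall>y\<in>L. \<phi> (br x y) = br' (\<phi> x) (\<phi> y))"

text \<open>Maps \<open>L \<rightarrow> L\<close> are represented by functions on the ambient type that vanish outside \<open>L\<close>,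
  so that equality of representatives is equality on \<open>L\<close> and the pointwise operations
  (addition is the one of \<^theory>\<open>HOL-Library.Function_Algebras\<close>) make sense.\<close>

definition fun_scale :: "('k \<Rightarrow> 'a \<Rightarrow> 'a) \<Rightarrow> 'k \<Rightarrow> ('a \<Rightarrow> 'a) \<Rightarrow> 'a \<Rightarrow> 'a" where
  "fun_scale scl c D = (\<lambda>x. scl c (D x))"

definition fun_commutator :: "('a \<Rightarrow> 'a) \<Rightarrow> ('a \<Rightarrow> 'a) \<Rightarrow> 'a \<Rightarrow> 'a::ab_group_add" where
  "fun_commutator D E = (D \<circ> E) - (E \<circ> D)"

definition Der :: "('k \<Rightarrow> 'a::ab_group_add \<Rightarrow> 'a) \<Rightarrow> 'a set \<Rightarrow> ('a \<Rightarrow> 'a \<Rightarrow> 'a) \<Rightarrow> ('a \<Rightarrow> 'a) set" where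
  "Der scl L br = {D.
     D ` L \<subseteq> L \<and> (\<forall>x. x \<notin> L \<longrightarrow> D x = 0) \<and>
     (\<forall>x\<in>L. \<forall>y\<in>L. D (x + y) = D x + D y) \<and>
     (\<forall>c. \<forall>x\<in>L. D (scl c x) = scl c (D x)) \<and>
     (\<forall>x\<in>L. \<forall>y\<in>L. D (br x y) = br (D x) y + br x (D y))}"

definition ad :: "'a set \<Rightarrow> ('a \<Rightarrow> 'a \<Rightarrow> 'a) \<Rightarrow> 'a \<Rightarrow> 'a \<Rightarrow> 'a::ab_group_add" where
  "ad L br x = (\<lambda>y. if y \<in> L then br x y else 0)"

definition Inn :: "'a::ab_group_add set \<Rightarrow> ('a \<Rightarrow> 'a \<Rightarrow> 'a) \<Rightarrow> ('a \<Rightarrow> 'a) set" where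
  "Inn L br = ad L br ` L"

definition taut :: "('k::field \<Rightarrow> 'a::ab_group_add \<Rightarrow> 'a) \<Rightarrow> 'a set \<Rightarrow> ('a \<Rightarrow> 'a \<Rightarrow> 'a) \<Rightarrow> bool" where
  "taut scl L br \<longleftrightarrow>
     (\<forall>\<phi>. lie_hom scl L br (fun_scale scl) (Der scl L br) fun_commutator \<phi> \<longrightarrow>
          \<phi> ` L \<subseteq> Inn L br)"

context lie_algebra
begin

lemma carrier_closed:
  "0 \<in> L" "x \<in> L \<Longrightarrow> y \<in> L \<Longrightarrow> x + y \<in> L" "x \<in> L \<Longrightarrow> y \<in> L \<Longrightarrow> x - y \<in> L"
  "x \<in> L \<Longrightarrow> - x \<in> L" "x \<in> L \<Longrightarrow> scl c x \<in> L"
  using subspace_carrier by (auto simp: subspace_0 subspace_add subspace_diff subspace_neg subspace_scale)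

lemma br_0: "x \<in> L \<Longrightarrow> br 0 x = 0" "x \<in> L \<Longrightarrow> br x 0 = 0"
  using br_scale_left[of x x 0] br_scale_right[of x x 0] by auto

lemma br_diff:
  assumes "x \<in> L" "y \<in> L" "z \<in> L"
  shows "br (x - y) z = br x z - br y z" "br x (y - z) = br x y - br x z"
  using br_add_left[of "x - y" y z] br_add_right[of x "y - z" z] assms
  by (simp_all add: carrier_closed algebra_simps)

lemma br_anti:
  assumes "x \<in> L" "y \<in> L"
  shows "br y x = - br x y"
proof -
  have "br x y + br y x = 0"
    using br_self[of "x + y"] br_add_left[of x y "x + y"] br_add_right[of x x y]
      br_add_right[of y x y] br_self[of x] br_self[of y] carrier_closed(2)[of x y] assms
    by simp
  then show ?thesis
    by (simp add: add_eq_0_iff)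
qed

sublocale fun_space: vector_space "fun_scale scl"
  by unfold_locales (auto simp: fun_scale_def fun_eq_iff scale_right_distrib scale_left_distrib)

lemma Der_lie_algebra: "lie_algebra (fun_scale scl) (Der scl L br) fun_commutator"
proof unfold_locales
  show "fun_space.subspace (Der scl L br)"
    unfolding fun_space.subspace_def
    by (auto simp: Der_def fun_scale_def image_subset_iff carrier_closed br_0 br_add_left
        br_add_right br_scale_left br_scale_right scale_right_distrib scale_left_commute algebra_simps)
next
  fix D E assume D: "D \<in> Der scl L br" and E: "E \<in> Der scl L br"
  have D0: "D 0 = 0" and E0: "E 0 = 0"
    using D E carrier_closed(1) scale_zero_left by (auto simp: Der_def) (metis scale_zero_left)+
  show "fun_commutator D E \<in> Der scl L br"
    using D E D0 E0
    by (auto simp: Der_def fun_commutator_def image_subset_iff carrier_closed br_closed br_diff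
        br_0 scale_right_diff_distrib)
next
  fix D E F assume "D \<in> Der scl L br" "E \<in> Der scl L br" "F \<in> Der scl L br"
  note DEF = this
  have cl: "G x \<in> L" if "G \<in> Der scl L br" for G x
    using that carrier_closed(1) by (cases "x \<in> L") (auto simp: Der_def)
  have ad: "G (x + y) = G x + G y" if "G \<in> Der scl L br" "x \<in> L" "y \<in> L" for G x y
    using that by (auto simp: Der_def)
  have di: "G (x - y) = G x - G y" if "G \<in> Der scl L br" "x \<in> L" "y \<in> L" for G x y
    using ad[OF that(1), of "x - y" y] that by (simp add: carrier_closed algebra_simps)
  show "fun_commutator (D + E) F = fun_commutator D F + fun_commutator E F"
    using DEF by (auto simp: fun_commutator_def fun_eq_iff ad cl)
  show "fun_commutator D (E + F) = fun_commutator D E + fun_commutator D F"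
    using DEF by (auto simp: fun_commutator_def fun_eq_iff ad cl)
  show "fun_commutator D (fun_commutator E F) + fun_commutator E (fun_commutator F D)
      + fun_commutator F (fun_commutator D E) = 0"
    using DEF by (auto simp: fun_commutator_def fun_eq_iff di cl)
next
  fix c D E assume DE: "D \<in> Der scl L br" "E \<in> Der scl L br"
  have cl: "G x \<in> L" if "G \<in> Der scl L br" for G x
    using that carrier_closed(1) by (cases "x \<in> L") (auto simp: Der_def)
  have sc: "G (scl c x) = scl c (G x)" if "G \<in> Der scl L br" "x \<in> L" for G x
    using that by (auto simp: Der_def)
  show "fun_commutator (fun_scale scl c D) E = fun_scale scl c (fun_commutator D E)"
    "fun_commutator D (fun_scale scl c E) = fun_scale scl c (fun_commutator D E)"
    using DE by (auto simp: fun_commutator_def fun_scale_def fun_eq_iff sc cl scale_right_diff_distrib)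
qed (simp add: fun_commutator_def)

lemma Inn_subset_Der: "Inn L br \<subseteq> Der scl L br"
proof
  fix D assume "D \<in> Inn L br"
  then obtain x where x: "x \<in> L" and D: "D = ad L br x"
    by (auto simp: Inn_def)
  have "br x (br y z) = br (br x y) z + br y (br x z)" if "y \<in> L" "z \<in> L" for y z
  proof -
    have "br (br x y) z = - br z (br x y)" "br y (br z x) = - br y (br x z)"
      using that x br_scale_right[of y "br x z" "- 1"]
      by (simp_all add: br_anti[of "br x y" z] br_anti[of x z] br_closed)
    then show ?thesis
      using br_jacobi[OF x that] by (simp add: algebra_simps)
  qed
  then show "D \<in> Der scl L br"
    using x by (auto simp: D ad_def Der_def br_closed br_add_right br_scale_right carrier_closed)
qed

end

definition mat_scale :: "'k::times \<Rightarrow> 'k^'n^'m \<Rightarrow> 'k^'n^'m" where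
  "mat_scale c A = (\<chi> i j. c * A $ i $ j)"

definition mat_commutator :: "'k::ring_1^'n^'n \<Rightarrow> 'k^'n^'n \<Rightarrow> 'k^'n^'n" where
  "mat_commutator A B = A ** B - B ** A"

definition sl3 :: "('k::ring_1^3^3) set" where
  "sl3 = {A. trace A = 0}"

lemma mat_commutator_nth:
  "mat_commutator A B $ i $ j = (\<Sum>k\<in>UNIV. A $ i $ k * B $ k $ j) - (\<Sum>k\<in>UNIV. B $ i $ k * A $ k $ j)"
  by (simp add: mat_commutator_def matrix_matrix_mult_def)

interpretation mat_space: vector_space "mat_scale :: 'k::field \<Rightarrow> 'k^'n^'m \<Rightarrow> 'k^'n^'m"
  by unfold_locales (auto simp: mat_scale_def vec_eq_iff algebra_simps)

interpretation sl3: lie_algebra mat_scale "sl3 :: ('k::field^3^3) set" mat_commutator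
proof unfold_locales
  show "mat_space.subspace (sl3 :: ('k^3^3) set)"
    by (auto simp: mat_space.subspace_def sl3_def mat_scale_def trace_def sum.distrib
        simp flip: sum_distrib_left)
qed (auto simp: sl3_def mat_scale_def vec_eq_iff mat_commutator_nth trace_def sum_3 algebra_simps)

text \<open>In characteristic 3 the identity has trace zero, and the center is spanned by it.\<close>

lemma center_sl3:
  assumes "CARD('k::field) = 3"
  shows "lie_center (sl3 :: ('k^3^3) set) mat_commutator = mat_space.span {mat 1}"
proof -
  have "finite (UNIV :: 'k set)"
    using assms by (simp add: card_ge_0_finite)
  then have "(\<Sum>x\<in>UNIV. x + 1) = (\<Sum>x\<in>(UNIV :: 'k set). x)"
    by (intro sum.reindex_bij_witness[of _ "\<lambda>x. x - 1" "\<lambda>x. x + 1"]) auto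
  then have three: "(1 :: 'k) + 1 + 1 = 0"
    by (simp add: sum.distrib assms)
  show ?thesis
  proof (intro equalityI subsetI)
    fix Z :: "'k^3^3" assume Z: "Z \<in> lie_center sl3 mat_commutator"
    define E :: "3 \<Rightarrow> 3 \<Rightarrow> 'k^3^3" where "E = (\<lambda>i j. \<chi> a b. if a = i \<and> b = j then 1 else 0)"
    have com: "(if b = j then Z $ a $ i else 0) = (if a = i then Z $ j $ b else 0)" if "i \<noteq> j" for i j a b
    proof -
      have "E i j \<in> sl3"
        using that by (auto simp: sl3_def trace_def E_def intro!: sum.neutral)
      then have "mat_commutator Z (E i j) $ a $ b = 0"
        using Z by (simp add: lie_center_def)
      moreover have "(\<Sum>k\<in>UNIV. Z $ a $ k * E i j $ k $ b) = (\<Sum>k\<in>UNIV. if k = i then (if b = j then Z $ a $ i else 0) else 0)"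
        by (rule sum.cong) (auto simp: E_def)
      moreover have "(\<Sum>k\<in>UNIV. E i j $ a $ k * Z $ k $ b) = (\<Sum>k\<in>UNIV. if k = j then (if a = i then Z $ j $ b else 0) else 0)"
        by (rule sum.cong) (auto simp: E_def)
      ultimately show ?thesis
        by (simp add: mat_commutator_nth)
    qed
    have "Z $ a $ b = 0" if "a \<noteq> b" for a b
      using com[of b a a a] that by auto
    moreover have "Z $ a $ a = Z $ 1 $ 1" for a
      using com[of a 1 1 a] com[of a 1 a 1] by (cases "a = 1") auto
    ultimately have "Z = mat_scale (Z $ 1 $ 1) (mat 1)"
      by (auto simp: vec_eq_iff mat_scale_def mat_def)
    then show "Z \<in> mat_space.span {mat 1}"
      unfolding mat_space.span_singleton by blast
  next
    fix Z :: "'k^3^3" assume "Z \<in> mat_space.span {mat 1}"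
    then obtain c where "Z = mat_scale c (mat 1)"
      unfolding mat_space.span_singleton by blast
    moreover have "mat 1 \<in> lie_center (sl3 :: ('k^3^3) set) mat_commutator"
    proof -
      have "trace (mat 1 :: 'k^3^3) = 0"
        using three by (simp only: trace_def sum_3) (simp add: mat_def)
      moreover have "mat_commutator (mat 1) A = 0" for A :: "'k^3^3"
        by (simp add: mat_commutator_def)
      ultimately show ?thesis
        by (simp add: lie_center_def sl3_def)
    qed
    ultimately show "Z \<in> lie_center sl3 mat_commutator"
      by (auto simp: lie_center_def sl3.carrier_closed sl3.br_scale_left)
  qed
qed

definition psl3_rel :: "'k::field^3^3 \<Rightarrow> 'k^3^3 \<Rightarrow> bool" where
  "psl3_rel A B \<longleftrightarrow> A \<in> sl3 \<and> B \<in> sl3 \<and> A - B \<in> lie_center sl3 mat_commutator"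

lemma subspace_center: "mat_space.subspace (lie_center (sl3 :: ('k::field^3^3) set) mat_commutator)"
  unfolding mat_space.subspace_def
  by (auto simp: lie_center_def sl3.carrier_closed sl3.br_0 sl3.br_add_left sl3.br_scale_left)

lemmas center_closed =
  mat_space.subspace_0[OF subspace_center] mat_space.subspace_add[OF subspace_center]
  mat_space.subspace_diff[OF subspace_center] mat_space.subspace_neg[OF subspace_center]
  mat_space.subspace_scale[OF subspace_center]

text \<open>Elements are the cosets of the center in \<open>sl3\<close>.\<close>

quotient_type (overloaded) 'k psl3 = "'k::field^3^3" / partial: psl3_rel
proof (rule part_equivpI)
  show "\<exists>A. psl3_rel A (A :: 'k^3^3)"
    by (rule exI[of _ 0]) (auto simp: psl3_rel_def sl3.carrier_closed center_closed)
  show "symp (psl3_rel :: 'k^3^3 \<Rightarrow> _)"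
    using center_closed(4) by (fastforce simp: symp_def psl3_rel_def)
  show "transp (psl3_rel :: 'k^3^3 \<Rightarrow> _)"
    using center_closed(2) by (fastforce simp: transp_def psl3_rel_def)
qed

instantiation psl3 :: (field) ab_group_add
begin

lift_definition zero_psl3 :: "'a psl3" is 0
  by (auto simp: psl3_rel_def sl3.carrier_closed center_closed)

lift_definition plus_psl3 :: "'a psl3 \<Rightarrow> 'a psl3 \<Rightarrow> 'a psl3" is "(+)"
  by (auto simp: psl3_rel_def sl3.carrier_closed add_diff_add center_closed)

lift_definition uminus_psl3 :: "'a psl3 \<Rightarrow> 'a psl3" is uminus
proof -
  fix A B :: "'a^3^3" assume "psl3_rel A B"
  moreover have "- A - - B = - (A - B)"
    by simp
  ultimately show "psl3_rel (- A) (- B)"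
    by (metis psl3_rel_def sl3.carrier_closed(4) center_closed(4))
qed

lift_definition minus_psl3 :: "'a psl3 \<Rightarrow> 'a psl3 \<Rightarrow> 'a psl3" is "(-)"
proof -
  fix A A' B B' :: "'a^3^3" assume "psl3_rel A A'" "psl3_rel B B'"
  moreover have "A - B - (A' - B') = (A - A') - (B - B')"
    by simp
  ultimately show "psl3_rel (A - B) (A' - B')"
    by (metis psl3_rel_def sl3.carrier_closed(3) center_closed(3))
qed

instance
  by standard (transfer; auto simp: psl3_rel_def sl3.carrier_closed center_closed algebra_simps)+

end

lift_definition psl3_scale :: "'k::field \<Rightarrow> 'k psl3 \<Rightarrow> 'k psl3" is mat_scale
  by (auto simp: psl3_rel_def sl3.carrier_closed center_closed simp flip: mat_space.scale_right_diff_distrib)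

lift_definition psl3_bracket :: "'k::field psl3 \<Rightarrow> 'k psl3 \<Rightarrow> 'k psl3" is mat_commutator
proof -
  fix A A' B B' :: "'k^3^3" assume *: "psl3_rel A A'" "psl3_rel B B'"
  then have "mat_commutator (A - A') B = 0" "mat_commutator (B - B') A' = 0"
    by (auto simp: psl3_rel_def lie_center_def)
  then have "mat_commutator A B - mat_commutator A' B' = 0"
    using * sl3.br_anti[of B A'] sl3.br_anti[of B' A'] by (simp add: psl3_rel_def sl3.br_diff)
  then show "psl3_rel (mat_commutator A B) (mat_commutator A' B')"
    using * center_closed(1) by (auto simp: psl3_rel_def sl3.br_closed)
qed

lemma psl3_rel_refl: "A \<in> sl3 \<Longrightarrow> psl3_rel A A"
  by (simp add: psl3_rel_def center_closed)

interpretation psl3: lie_algebra psl3_scale "UNIV :: 'k::field psl3 set" psl3_bracket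
proof -
  have rel: "A \<in> sl3" if "psl3_rel A A" for A :: "'k^3^3"
    using that by (simp add: psl3_rel_def)
  interpret vector_space "psl3_scale :: 'k \<Rightarrow> 'k psl3 \<Rightarrow> 'k psl3"
    by unfold_locales (transfer; auto dest!: rel intro!: psl3_rel_refl
        simp: sl3.carrier_closed mat_space.scale_right_distrib mat_space.scale_left_distrib)+
  show "lie_algebra psl3_scale (UNIV :: 'k psl3 set) psl3_bracket"
    by unfold_locales (simp_all, (transfer; auto dest!: rel intro!: psl3_rel_refl
        simp: sl3.carrier_closed sl3.br_closed sl3.br_add_left sl3.br_add_right
          sl3.br_scale_left sl3.br_scale_right sl3.br_self sl3.br_jacobi)+)
qed

end

theory Submission
  imports Defs
begin

text \<open>Let \<open>g = psl3\<close>. In octonion coordinates \<open>g = k h + V + V*\<close> with \<open>dim V = 3\<close>, and every derivation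
  of \<open>g\<close> is the sum of an element of \<open>sl(V)\<close> and an inner derivation, so that \<open>Der g / Inn g\<close> is
  \<open>sl(V)\<close> modulo scalars, again isomorphic to \<open>g\<close>. As \<open>g\<close> is simple, a homomorphism \<open>g \<rightarrow> Der g\<close>
  that is not inner induces an automorphism of \<open>g\<close> modulo inner derivations; undoing it, one gets a
  homomorphism \<open>\<Phi> : sl(V) \<rightarrow> Der g\<close> that kills the scalars and satisfies \<open>\<Phi> X \<equiv> X\<close> modulo \<open>Inn g\<close>.
  The derivation \<open>\<Phi> X\<close> maps \<open>h\<close> into the 6-dimensional space \<open>V + V*\<close>, so \<open>\<Phi> A = A\<close> for some \<open>A \<noteq> 0\<close> in
  the 8-dimensional \<open>sl(V)\<close>. Comparing \<open>ad(A)\<^sup>3 = ad(A\<^sup>3)\<close> with the Cayley-Hamilton theorem gives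
  \<open>det A = 0\<close>. If \<open>A\<close> is regular nilpotent, then the identity is a commutator \<open>[A, B]\<close>, which is
  impossible. Otherwise \<open>A\<close> is conjugate to \<open>E\<^sub>1\<^sub>2 + m E\<^sub>2\<^sub>1\<close>, and the relations among
  \<open>\<Phi>(E\<^sub>1\<^sub>3)\<close>, \<open>\<Phi>(E\<^sub>2\<^sub>3)\<close>, \<open>\<Phi>(E\<^sub>3\<^sub>1)\<close>, \<open>\<Phi>(E\<^sub>3\<^sub>2)\<close> have no solution over the field with
  three elements.\<close>

section \<open>Vectors in characteristic 3\<close>

text \<open>Translation by 1 permutes the field, so the sum of three ones vanishes; then 0, 1 and -1
  are distinct and exhaust it.\<close>

lemma field_card_3:
  assumes "CARD('k::field) = 3"
  shows "(3 :: 'k) = 0" and "(x :: 'k) = 0 \<or> x = 1 \<or> x = -1"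
proof -
  have fin: "finite (UNIV :: 'k set)"
    using assms by (simp add: card_ge_0_finite)
  then have "(\<Sum>x\<in>UNIV. x + 1) = (\<Sum>x\<in>(UNIV :: 'k set). x)"
    by (intro sum.reindex_bij_witness[of _ "\<lambda>x. x - 1" "\<lambda>x. x + 1"]) auto
  then show three: "(3 :: 'k) = 0"
    by (simp add: sum.distrib assms)
  have "(1 :: 'k) \<noteq> - 1"
  proof
    assume "(1 :: 'k) = - 1"
    then have "(1 :: 'k) + 1 = 0"
      by (metis add.right_inverse)
    with three show False
      by (metis one_plus_numeral one_add_one semiring_norm(3) add_0_right zero_neq_one)
  qed
  then have "card {0, 1, - 1 :: 'k} = CARD('k)"
    by (simp add: assms)
  then have "{0, 1, - 1 :: 'k} = UNIV"
    using fin by (intro card_subset_eq) auto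
  then show "x = 0 \<or> x = 1 \<or> x = -1"
    by blast
qed

lemma two_char_3: "(3 :: 'k::field) = 0 \<Longrightarrow> (2 :: 'k) = - 1"
  by (metis add_eq_0_iff one_plus_numeral semiring_norm(3))

lemma double_char_3:
  fixes x y :: "'k::field"
  assumes "(3 :: 'k) = 0"
  shows "x + x = - x" and "x + (x + y) = y - x"
    and "- x - x = x" and "- x + (- x + y) = x + y"
proof -
  show xx: "x + x = - x"
    using two_char_3[OF assms] by (simp flip: mult_2)
  show "x + (x + y) = y - x"
    by (metis xx add.assoc uminus_add_conv_diff)
  show "- x - x = x"
    by (metis xx diff_conv_add_uminus minus_add_distrib minus_minus)
  then show "- x + (- x + y) = x + y"
    by (metis add.assoc diff_conv_add_uminus)
qed

lemma vec_double_char_3: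
  fixes x y :: "'k::field^'n"
  assumes "(3 :: 'k) = 0"
  shows "x + x = - x" and "- x = y + x \<longleftrightarrow> y = x" and "x = - y - x \<longleftrightarrow> x = y"
proof -
  show xx: "x + x = - x"
    by (simp add: vec_eq_iff assms double_char_3[OF assms])
  have "- x - x = x"
    by (simp add: vec_eq_iff assms double_char_3[OF assms])
  then show "- x = y + x \<longleftrightarrow> y = x"
    using eq_diff_eq[of y "- x" x] by metis
  show "x = - y - x \<longleftrightarrow> x = y"
    unfolding eq_diff_eq xx by simp
qed

definition dotp :: "'k::comm_ring_1^3 \<Rightarrow> 'k^3 \<Rightarrow> 'k" where
  "dotp v w = v $ 1 * w $ 1 + v $ 2 * w $ 2 + v $ 3 * w $ 3"

definition crossp :: "'k::comm_ring_1^3 \<Rightarrow> 'k^3 \<Rightarrow> 'k^3" where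
  "crossp v w = vector [v $ 2 * w $ 3 - v $ 3 * w $ 2, v $ 3 * w $ 1 - v $ 1 * w $ 3,
     v $ 1 * w $ 2 - v $ 2 * w $ 1]"

lemma dotp_0 [simp]: "dotp 0 x = 0" "dotp x 0 = 0"
  by (simp_all add: dotp_def)

lemma crossp_0 [simp]: "crossp 0 x = 0" "crossp x 0 = 0"
  by (simp_all add: crossp_def vec_eq_iff forall_3)

lemma dotp_minus: "dotp (- x) y = - dotp x y" "dotp x (- y) = - dotp x y"
  by (simp_all add: dotp_def)

lemma crossp_minus: "crossp (- x) y = - crossp x y" "crossp x (- y) = - crossp x y"
  by (simp_all add: crossp_def vec_eq_iff forall_3)

lemma dotp_add: "dotp (x + y) z = dotp x z + dotp y z" "dotp x (y + z) = dotp x y + dotp x z"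
  by (simp_all add: dotp_def algebra_simps)

lemma crossp_add:
  "crossp (x + y) z = crossp x z + crossp y z"
  "crossp x (y + z) = crossp x y + crossp x z"
  by (simp_all add: crossp_def vec_eq_iff forall_3 algebra_simps)

lemma dotp_scale: "dotp (c *s x) y = c * dotp x y" "dotp x (c *s y) = c * dotp x y"
  by (simp_all add: dotp_def algebra_simps)

lemma crossp_scale: "crossp (c *s x) y = c *s crossp x y" "crossp x (c *s y) = c *s crossp x y"
  by (simp_all add: crossp_def vec_eq_iff forall_3 algebra_simps)

lemma dotp_axis: "dotp (axis i 1) x = x $ i" "dotp x (axis i 1) = x $ i"
  using exhaust_3[of i] by (auto simp: dotp_def axis_def)

lemma crossp_anti: "crossp y x = - crossp x y"
  by (simp add: crossp_def vec_eq_iff forall_3)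

lemma dotp_transform: "dotp (G *v x) y = dotp x (y v* G)"
  by (simp add: dotp_def matrix_vector_mult_def vector_matrix_mult_def sum_3 algebra_simps)

text \<open>Paired with a third vector, a cross product becomes a determinant of three vectors,
  which \<open>G\<close> multiplies by \<open>det G\<close>.\<close>

lemma crossp_transform:
  fixes G :: "'k::comm_ring_1^3^3"
  shows "G *v crossp (x v* G) (y v* G) = det G *s crossp x y"
    and "crossp (G *v x) (G *v y) v* G = det G *s crossp x y"
  by (simp_all add: vec_eq_iff forall_3 crossp_def matrix_vector_mult_def vector_matrix_mult_def
      sum_3 det_3 algebra_simps)

lemma matrix_vector_mult_minus:
  fixes A :: "'a::ring_1^'n^'m"
  shows "A *v (- x) = - (A *v x)" and "(- y) v* A = - (y v* A)"
  by (simp_all add: vec_eq_iff matrix_vector_mult_def vector_matrix_mult_def sum_negf)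

lemma matrix_mult_distrib:
  fixes A :: "'k::ring_1^'n^'m"
  shows "(A + A') ** B = A ** B + A' ** B" and "(A - A') ** B = A ** B - A' ** B"
    and "A ** (B - B') = A ** B - A ** B'"
  by (simp_all add: vec_eq_iff matrix_matrix_mult_def sum.distrib sum_subtractf algebra_simps)

lemma matrix_mult_scale:
  fixes A :: "'k::comm_ring_1^'n^'m"
  shows "mat_scale c A ** B = mat_scale c (A ** B)" and "A ** mat_scale c B = mat_scale c (A ** B)"
  by (simp_all add: vec_eq_iff matrix_matrix_mult_def mat_scale_def sum_distrib_left ac_simps)

lemma scalar_commutator:
  fixes A :: "'k::comm_ring_1^'n^'n"
  shows "mat_commutator (mat_scale c (mat 1)) A = 0"
    and "mat_commutator (A - mat_scale c (mat 1)) B = mat_commutator A B"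
    and "mat_commutator A (B - mat_scale c (mat 1)) = mat_commutator A B"
  by (simp_all add: mat_commutator_def matrix_mult_distrib matrix_mult_scale)

section \<open>Octonion coordinates\<close>

lemma psl3_rel_iff:
  assumes "CARD('k::field) = 3"
  shows "psl3_rel A B \<longleftrightarrow> A \<in> sl3 \<and> B \<in> sl3 \<and> (\<exists>c. A - B = mat_scale c (mat 1 :: 'k^3^3))"
  unfolding psl3_rel_def center_sl3[OF assms] mat_space.span_singleton by auto

text \<open>In characteristic 3 the trace-zero split octonions form a Lie algebra under the commutator,
  and it is isomorphic to \<open>psl3\<close>. Here \<open>oct a v f\<close> is the element with Zorn coordinates
  \<open>(a, v, f)\<close>: \<open>v\<close> lists the root vectors 12, 23, 31 and \<open>f\<close> the opposite ones 21, 32, 13.\<close>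
lift_definition oct :: "'k::field \<Rightarrow> 'k^3 \<Rightarrow> 'k^3 \<Rightarrow> 'k psl3" is
  "\<lambda>a v f. vector [vector [a, v $ 1, f $ 3], vector [f $ 1, - a, v $ 2], vector [v $ 3, f $ 2, 0]]"
  by (intro psl3_rel_refl) (simp add: sl3_def trace_def sum_3)

lemma oct_eq_iff:
  assumes "CARD('k::field) = 3"
  shows "oct a v f = oct b w (g :: 'k^3) \<longleftrightarrow> a = b \<and> v = w \<and> f = g"
  by transfer
    (auto simp: psl3_rel_iff[OF assms] sl3_def trace_def vec_eq_iff forall_3 sum_3 mat_scale_def mat_def)

lemma oct_cases:
  assumes "CARD('k::field) = 3"
  obtains a v f where "x = oct a v (f :: 'k^3)"
proof -
  have "\<exists>a v f. x = oct a v f"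
  proof transfer
    fix X :: "'k^3^3" assume "psl3_rel X X"
    then have "X \<in> sl3"
      by (simp add: psl3_rel_def)
    then have X: "X $ 1 $ 1 + X $ 2 $ 2 + X $ 3 $ 3 = 0"
      by (simp add: sl3_def trace_def sum_3)
    \<comment> \<open>Subtracting this multiple of the identity clears the lower right entry and, as
      3 = 0, keeps the trace zero.\<close>
    let ?c = "X $ 3 $ 3"
    have "X $ 1 $ 1 + X $ 2 $ 2 = - ?c"
      using X by (simp add: eq_neg_iff_add_eq_0)
    then have "psl3_rel X (vector [vector [X $ 1 $ 1 - ?c, X $ 1 $ 2, X $ 1 $ 3],
        vector [X $ 2 $ 1, - (X $ 1 $ 1 - ?c), X $ 2 $ 3], vector [X $ 3 $ 1, X $ 3 $ 2, 0]])"
      using \<open>X \<in> sl3\<close> unfolding psl3_rel_iff[OF assms]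
      by (intro conjI exI[of _ ?c])
        (auto simp: sl3_def trace_def vec_eq_iff forall_3 sum_3 mat_scale_def mat_def
          algebra_simps double_char_3[OF field_card_3(1)[OF assms]])
    then show "\<exists>a (v :: 'k^3) (f :: 'k^3). psl3_rel X (vector [vector [a, v $ 1, f $ 3],
        vector [f $ 1, - a, v $ 2], vector [v $ 3, f $ 2, 0]])"
      by (intro exI[of _ "X $ 1 $ 1 - ?c"] exI[of _ "vector [X $ 1 $ 2, X $ 2 $ 3, X $ 3 $ 1]"]
          exI[of _ "vector [X $ 2 $ 1, X $ 3 $ 2, X $ 1 $ 3]"]) simp
  qed
  with that show ?thesis
    by blast
qed

lemma oct_0: "0 = oct 0 0 0"
  by transfer (rule arg_cong2[of _ _ _ _ psl3_rel, THEN iffD2, OF _ refl psl3_rel_refl];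
    simp add: sl3_def trace_def vec_eq_iff forall_3 sum_3)

lemma oct_add: "oct a v f + oct b w g = oct (a + b) (v + w) (f + g)"
  by transfer (rule arg_cong2[of _ _ _ _ psl3_rel, THEN iffD2, OF _ refl psl3_rel_refl];
    simp add: sl3_def trace_def vec_eq_iff forall_3 sum_3)

lemma oct_diff: "oct a v f - oct b w g = oct (a - b) (v - w) (f - g)"
  using oct_add[of "a - b" "v - w" "f - g" b w g] by (simp add: diff_eq_eq)

lemma oct_scale: "psl3_scale c (oct a v f) = oct (c * a) (c *s v) (c *s f)"
  by transfer (rule arg_cong2[of _ _ _ _ psl3_rel, THEN iffD2, OF _ refl psl3_rel_refl];
    simp add: sl3_def trace_def vec_eq_iff forall_3 sum_3 mat_scale_def)

text \<open>In characteristic 3 the roots 12, 23 and 31 all take the value -1 on diag(1, -1, 0), so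
  \<open>oct 1 0 0\<close> acts by -1 on the whole of \<open>V\<close> and by 1 on its dual.\<close>

lemma oct_bracket:
  assumes "CARD('k::field) = 3"
  shows "psl3_bracket (oct a v f) (oct b w (g :: 'k^3)) =
    oct (dotp v g - dotp w f) (b *s v - a *s w - crossp f g) (a *s g - b *s f + crossp v w)"
proof transfer
  fix a b :: 'k and v f w g :: "'k^3"
  let ?M = "\<lambda>a (v :: 'k^3) (f :: 'k^3).
    vector [vector [a, v $ 1, f $ 3], vector [f $ 1, - a, v $ 2], vector [v $ 3, f $ 2, 0]] :: 'k^3^3"
  \<comment> \<open>The lower right entry of the commutator, to be shifted away to return to the
    chosen representatives.\<close>
  let ?c = "v $ 3 * g $ 3 + f $ 2 * w $ 2 - w $ 3 * f $ 3 - g $ 2 * v $ 2"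
  have sl: "?M a v f \<in> sl3" for a v f
    by (simp add: sl3_def trace_def sum_3)
  have "mat_commutator (?M a v f) (?M b w g) -
      ?M (dotp v g - dotp w f) (b *s v - a *s w - crossp f g) (a *s g - b *s f + crossp v w) =
    mat_scale ?c (mat 1)"
    by (simp add: vec_eq_iff forall_3 sum_3 mat_scale_def mat_def dotp_def crossp_def
        mat_commutator_nth; simp add: algebra_simps field_card_3(1)[OF assms]
        double_char_3[OF field_card_3(1)[OF assms]])
  then show "psl3_rel (mat_commutator (?M a v f) (?M b w g))
      (?M (dotp v g - dotp w f) (b *s v - a *s w - crossp f g) (a *s g - b *s f + crossp v w))"
    unfolding psl3_rel_iff[OF assms] by (blast intro: sl sl3.br_closed)
qed

section \<open>Finiteness and simplicity of \<open>psl3\<close>\<close>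

lemma finite_psl3:
  assumes "CARD('k::field) = 3"
  shows "finite (UNIV :: 'k psl3 set)"
proof -
  have "(UNIV :: 'k psl3 set) = range (\<lambda>(a, v, f). oct a v f)"
    using oct_cases[OF assms] by (auto simp: image_iff) metis
  moreover have "finite (UNIV :: ('k \<times> ('k^3) \<times> ('k^3)) set)"
    by (rule card_ge_0_finite) (simp add: assms)
  ultimately show ?thesis
    by (metis finite_imageI)
qed

lemma psl3_abs_eq_iff:
  assumes "CARD('k::field) = 3" "X \<in> sl3" "Y \<in> sl3"
  shows "abs_psl3 X = abs_psl3 Y \<longleftrightarrow> (\<exists>c. X - Y = mat_scale c (mat 1 :: 'k^3^3))"
  using Quotient_rel[OF Quotient_psl3, of X Y] assms by (auto simp: psl3_rel_iff)

text \<open>Bracketing with \<open>oct 1 0 0\<close> separates the three components. A nonzero one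
  yields, if necessary by pairing with a basis vector, a nonzero multiple of
  \<open>oct 1 0 0\<close>, which generates everything.\<close>

lemma psl3_ideal:
  fixes J :: "'k::field psl3 set"
  assumes card: "CARD('k) = 3"
    and J: "\<And>x y. x \<in> J \<Longrightarrow> y \<in> J \<Longrightarrow> x + y \<in> J" "\<And>c x. x \<in> J \<Longrightarrow> psl3_scale c x \<in> J"
      "\<And>x y. x \<in> J \<Longrightarrow> psl3_bracket x y \<in> J"
    and x: "x \<in> J" "x \<noteq> 0"
  shows "y \<in> J"
proof -
  note br = oct_bracket[OF card]
  have two: "(2 :: 'k) = - 1"
    by (rule two_char_3[OF field_card_3(1)[OF card]])
  have double: "(2 :: 'k) *s u = - u" "u + u = - u" for u :: "'k^3"
    using double_char_3(1)[OF field_card_3(1)[OF card]] by (simp_all add: two vec_eq_iff)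
  obtain a v f where avf: "x = oct a v f"
    by (rule oct_cases[OF card])
  have x2: "oct 0 v (- f) \<in> J"
    using J(3)[OF x(1), of "oct 1 0 0"] by (simp add: avf br)
  have x3: "oct 0 v f \<in> J"
    using J(3)[OF x2, of "oct 1 0 0"] by (simp add: br)
  have a: "oct a 0 0 \<in> J"
    using J(1)[OF x(1) J(2)[OF x3, of "- 1"]] by (simp add: avf oct_scale oct_add vector_smult_lneg)
  have v: "oct 0 v 0 \<in> J"
    using J(2)[OF J(1)[OF x2 x3], of "- 1"] by (simp add: oct_scale oct_add double vector_smult_lneg)
  have f: "oct 0 0 f \<in> J"
    using J(1)[OF x3 J(2)[OF v, of "- 1"]] by (simp add: oct_scale oct_add vector_smult_lneg)
  have "\<exists>c. c \<noteq> 0 \<and> oct c 0 0 \<in> J"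
  proof -
    have "a \<noteq> 0 \<or> v \<noteq> 0 \<or> f \<noteq> 0"
      using x(2) by (auto simp: avf oct_0)
    then consider "a \<noteq> 0" | i where "v $ i \<noteq> 0" | i where "f $ i \<noteq> 0"
      by (auto simp: vec_eq_iff)
    then show ?thesis
    proof cases
      case 1
      with a show ?thesis
        by blast
    next
      case 2
      with J(3)[OF v, of "oct 0 0 (axis i 1)"] show ?thesis
        by (auto simp: br dotp_axis)
    next
      case 3
      with J(3)[OF f, of "oct 0 (axis i 1) 0"] show ?thesis
        by (intro exI[of _ "- f $ i"]) (simp add: br dotp_axis)
    qed
  qed
  then obtain c where c: "c \<noteq> 0" "oct c 0 0 \<in> J"
    by blast
  have h: "oct b 0 0 \<in> J" for b
    using J(2)[OF c(2), of "b / c"] c(1) by (simp add: oct_scale)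
  obtain b w g where y: "y = oct b w g"
    by (rule oct_cases[OF card])
  have "oct 0 w g \<in> J"
    using J(3)[OF h[of 1], of "oct 0 (- w) g"] by (simp add: br)
  from J(1)[OF h[of b] this] show ?thesis
    by (simp add: y oct_add)
qed

section \<open>Derivations\<close>

text \<open>\<open>oct_der D A v f\<close> says that \<open>D = A + ad (0, v, f)\<close>, where \<open>A\<close> acts on \<open>(a, w, g)\<close> as
  \<open>(0, A w, - g A)\<close>. As \<open>ad (1, 0, 0)\<close> acts like \<open>A = - mat 1\<close>, the first coordinate of the
  inner part is absorbed into \<open>A\<close>, which makes the triple \<open>(A, v, f)\<close> unique.\<close>
definition oct_der :: "('k::field psl3 \<Rightarrow> 'k psl3) \<Rightarrow> 'k^3^3 \<Rightarrow> 'k^3 \<Rightarrow> 'k^3 \<Rightarrow> bool" where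
  "oct_der D A v f \<longleftrightarrow> A \<in> sl3 \<and> (\<forall>b w g. D (oct b w g) =
     oct (dotp v g - dotp w f) (A *v w + b *s v - crossp f g) (crossp v w - b *s f - g v* A))"

lemma oct_der_sl3: "oct_der D A v f \<Longrightarrow> A \<in> sl3"
  by (simp add: oct_der_def)

lemma oct_der_apply: "oct_der D A v f \<Longrightarrow> D (oct b w g) =
    oct (dotp v g - dotp w f) (A *v w + b *s v - crossp f g) (crossp v w - b *s f - g v* A)"
  by (simp add: oct_der_def)

text \<open>Uniqueness turns identities between derivations into identities between their
  components.\<close>

lemma oct_der_unique:
  assumes card: "CARD('k::field) = 3" and D: "oct_der D A v f" "oct_der D B w (g :: 'k^3)"
  shows "A = B" "v = w" "f = g"
proof -
  show "v = w" "f = g"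
    using oct_der_apply[OF D(1), of 1 0 0] oct_der_apply[OF D(2), of 1 0 0]
    by (simp_all add: oct_eq_iff[OF card])
  have "A *v u = B *v u" for u
    using oct_der_apply[OF D(1), of 0 u 0] oct_der_apply[OF D(2), of 0 u 0]
    by (simp add: oct_eq_iff[OF card])
  then show "A = B"
    by (simp add: matrix_eq)
qed

lemma oct_der_add:
  assumes "oct_der D A v f" "oct_der E B w g"
  shows "oct_der (D + E) (A + B) (v + w) (f + g)"
  unfolding oct_der_def
  using oct_der_sl3[OF assms(1)] oct_der_sl3[OF assms(2)]
  by (simp add: sl3.carrier_closed oct_der_apply[OF assms(1)] oct_der_apply[OF assms(2)] oct_add
      dotp_add crossp_add algebra_simps
      vector_add_ldistrib)

lemma oct_der_scale:
  assumes "oct_der D A v f"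
  shows "oct_der (fun_scale psl3_scale c D) (mat_scale c A) (c *s v) (c *s f)"
proof -
  have "mat_scale c A *v u = c *s (A *v u)" "u v* mat_scale c A = c *s (u v* A)" for u
    by (simp_all add: vec_eq_iff matrix_vector_mult_def vector_matrix_mult_def mat_scale_def
        sum_distrib_left ac_simps)
  then show ?thesis
    unfolding oct_der_def using oct_der_sl3[OF assms]
    by (simp add: sl3.carrier_closed fun_scale_def oct_der_apply[OF assms] oct_scale dotp_scale
        crossp_scale vector_add_ldistrib vector_ssub_ldistrib right_diff_distrib mult.commute)
qed

text \<open>The scalar matrix is the action of \<open>oct (- c) 0 0\<close>.\<close>

lemma oct_der_inner:
  assumes card: "CARD('k::field) = 3" and D: "oct_der D (mat_scale c (mat 1)) v (f :: 'k^3)"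
  shows "D \<in> Inn UNIV psl3_bracket"
proof -
  have "D = ad UNIV psl3_bracket (oct (- c) v f)"
  proof
    fix x :: "'k psl3"
    obtain b w g where x: "x = oct b w g"
      by (rule oct_cases[OF card])
    have "mat_scale c (mat 1) *v u = c *s u" "u v* mat_scale c (mat 1) = c *s u" for u :: "'k^3"
      by (simp_all add: vec_eq_iff matrix_vector_mult_def vector_matrix_mult_def mat_scale_def
          mat_def sum_3 forall_3)
    then show "D x = ad UNIV psl3_bracket (oct (- c) v f) x"
      by (simp add: x oct_der_apply[OF D] ad_def oct_bracket[OF card] oct_eq_iff[OF card]
          vector_smult_lneg)
  qed
  then show ?thesis
    by (simp add: Inn_def)
qed

context
  fixes D :: "'k::field psl3 \<Rightarrow> 'k psl3"
  assumes card: "CARD('k) = 3" and D: "D \<in> Der psl3_scale UNIV psl3_bracket"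
begin

lemma Der_add: "D (x + y) = D x + D y"
  and Der_scale: "D (psl3_scale c x) = psl3_scale c (D x)"
  and Der_bracket: "D (psl3_bracket x y) = psl3_bracket (D x) y + psl3_bracket x (D y)"
  using D by (simp_all add: Der_def)

text \<open>Let h be \<open>oct 1 0 0\<close>. Applying \<open>D\<close> to [h, u] = -u on
  \<open>V\<close> and to [h, k] = k on the dual fixes \<open>D\<close> up to endomorphisms
  \<open>P\<close> and \<open>Q\<close>. The pairing makes \<open>Q\<close> the negative transpose
  of \<open>P\<close>, and the cross product forces trace zero.\<close>

lemma Der_oct_der: "\<exists>A v f. oct_der D A v f"
proof -
  note oct_eq = oct_eq_iff[OF card] and br = oct_bracket[OF card]
  note double = vec_double_char_3[OF field_card_3(1)[OF card]]
  have minus: "oct (- a) (- u) (- k) = psl3_scale (- 1) (oct a u k)" for a and u k :: "'k^3"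
    by (simp add: oct_scale vector_smult_lneg)
  obtain c w g where h: "D (oct 1 0 0) = oct c w g"
    by (rule oct_cases[OF card])
  have V: "\<exists>u'. D (oct 0 u 0) = oct (dotp u g) u' (crossp w u)"
    and c: "c *s u = 0" for u
  proof -
    obtain a v' f' where u: "D (oct 0 u 0) = oct a v' f'"
      by (rule oct_cases[OF card])
    have "psl3_scale (- 1) (D (oct 0 u 0)) =
        psl3_bracket (D (oct 1 0 0)) (oct 0 u 0) + psl3_bracket (oct 1 0 0) (D (oct 0 u 0))"
      by (simp add: br oct_scale vector_smult_lneg flip: Der_bracket Der_scale)
    then have "oct (- a) (- v') (- f') = oct (- dotp u g) (- (c *s u) - v') (crossp w u + f')"
      by (simp add: h u br oct_scale oct_add vector_smult_lneg)
    then have "a = dotp u g" "c *s u = 0" "crossp w u = f'"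
      by (simp_all add: oct_eq double)
    then show "\<exists>u'. D (oct 0 u 0) = oct (dotp u g) u' (crossp w u)" "c *s u = 0"
      by (auto simp: u)
  qed
  have c0: "c = 0"
    using c[of "vec 1"] by (simp add: vec_eq_iff)
  have F: "\<exists>k'. D (oct 0 0 k) = oct (dotp w k) (crossp g k) k'" for k
  proof -
    obtain a v' f' where k: "D (oct 0 0 k) = oct a v' f'"
      by (rule oct_cases[OF card])
    have "D (oct 0 0 k) =
        psl3_bracket (D (oct 1 0 0)) (oct 0 0 k) + psl3_bracket (oct 1 0 0) (D (oct 0 0 k))"
      by (simp add: br flip: Der_bracket)
    then have "oct a v' f' = oct (dotp w k) (- crossp g k - v') f'"
      by (simp add: h k br oct_add c0)
    then have "a = dotp w k" "v' = crossp g k"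
      by (simp_all add: oct_eq double)
    then show ?thesis
      by (auto simp: k)
  qed
  obtain P where P: "D (oct 0 u 0) = oct (dotp u g) (P u) (crossp w u)" for u
    using V by metis
  obtain Q where Q: "D (oct 0 0 k) = oct (dotp w k) (crossp g k) (Q k)" for k
    using F by metis
  have "Vector_Spaces.linear (*s) (*s) P"
  proof unfold_locales
    show "P (x + y) = P x + P y" for x y
      using Der_add[of "oct 0 x 0" "oct 0 y 0"] by (simp add: oct_add P oct_eq)
    show "P (r *s x) = r *s P x" for r x
      using Der_scale[of r "oct 0 x 0"] by (simp add: oct_scale P oct_eq)
  qed
  then have A: "P u = matrix P *v u" for u
    by (simp add: matrix_works)
  have PQ: "dotp (P u) k + dotp u (Q k) = 0" for u k
  proof -
    have "psl3_scale (dotp u k) (D (oct 1 0 0)) =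
        psl3_bracket (D (oct 0 u 0)) (oct 0 0 k) + psl3_bracket (oct 0 u 0) (D (oct 0 0 k))"
      by (simp add: br oct_scale flip: Der_bracket Der_scale)
    then show ?thesis
      by (simp add: h c0 P Q br oct_scale oct_add oct_eq)
  qed
  have Qk: "Q k = - (k v* matrix P)" for k
  proof -
    have "Q k $ i = - (k v* matrix P) $ i" for i
      using PQ[of "axis i 1" k] dotp_transform[of "matrix P" "axis i 1" k]
      by (simp add: A dotp_axis add_eq_0_iff)
    then show ?thesis
      by (simp add: vec_eq_iff)
  qed
  have "trace (matrix P) = 0"
  proof -
    let ?e = "axis 1 1 :: 'k^3" and ?e' = "axis 2 1 :: 'k^3"
    have "crossp ?e ?e' = axis 3 1"
      by (simp add: crossp_def axis_def vec_eq_iff forall_3)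
    then have "D (oct 0 0 (axis 3 1)) =
        psl3_bracket (D (oct 0 ?e 0)) (oct 0 ?e' 0) + psl3_bracket (oct 0 ?e 0) (D (oct 0 ?e' 0))"
      by (simp add: br flip: Der_bracket)
    then have "Q (axis 3 1) $ 3 = (dotp ?e g *s 0 + crossp (P ?e) ?e' + crossp ?e (P ?e')) $ 3"
      by (simp add: P Q br oct_add oct_eq)
    then have "- matrix P $ 3 $ 3 = matrix P $ 1 $ 1 + matrix P $ 2 $ 2"
      by (simp add: Qk A crossp_def axis_def sum_3 matrix_vector_mult_def vector_matrix_mult_def)
    then show ?thesis
      by (simp add: trace_def sum_3 flip: \<open>- matrix P $ 3 $ 3 = _\<close>)
  qed
  moreover have "D (oct b u k) = oct (dotp w k - dotp u (- g))
      (matrix P *v u + b *s w - crossp (- g) k) (crossp w u - b *s (- g) - k v* matrix P)" for b u k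
  proof -
    have "D (oct b u k) = psl3_scale b (D (oct 1 0 0)) + (D (oct 0 u 0) + D (oct 0 0 k))"
      by (simp add: oct_scale oct_add flip: Der_add Der_scale)
    then show ?thesis
      by (simp add: h c0 P Q oct_scale oct_add oct_eq crossp_minus dotp_minus Qk
          vector_smult_rneg flip: A)
  qed
  ultimately have "oct_der D (matrix P) w (- g)"
    by (simp add: oct_der_def sl3_def)
  then show ?thesis
    by blast
qed

end

text \<open>The scalar is the first coordinate of the bracket of the two inner parts, with a minus
  sign because \<open>oct 1 0 0\<close> acts like \<open>- mat 1\<close>. As the commutator is a
  derivation, its values at \<open>oct 1 0 0\<close> and on \<open>V\<close> suffice.\<close>

lemma oct_der_commutator:
  assumes card: "CARD('k::field) = 3"
    and D: "D \<in> Der psl3_scale UNIV psl3_bracket" "oct_der D A v f"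
    and E: "E \<in> Der psl3_scale UNIV psl3_bracket" "oct_der E B w (g :: 'k^3)"
  shows "oct_der (fun_commutator D E)
    (mat_commutator A B - mat_scale (dotp v g - dotp w f) (mat 1))
    (A *v w - B *v v - crossp f g) (f v* B - g v* A + crossp v w)"
proof -
  have "fun_commutator D E \<in> Der psl3_scale UNIV psl3_bracket"
    using lie_algebra.br_closed[OF psl3.Der_lie_algebra D(1) E(1)] .
  then obtain C p q where C: "oct_der (fun_commutator D E) C p q"
    using Der_oct_der[OF card] by blast
  note app = oct_der_apply[OF D(2)] oct_der_apply[OF E(2)]
  note double = vec_double_char_3(1)[OF field_card_3(1)[OF card]]
  note group = diff_conv_add_uminus minus_add_distrib minus_minus ac_simps
  have h: "oct 0 p (- q) = D (E (oct 1 0 0)) - E (D (oct 1 0 0))"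
    using oct_der_apply[OF C, of 1 0 0] by (simp add: fun_commutator_def)
  have p: "p = (A *v w + crossp f g) - (B *v v + crossp g f)"
    and q: "- q = (crossp v w + g v* A) - (crossp w v + f v* B)"
    using h by (simp_all add: app oct_diff oct_eq_iff[OF card] matrix_vector_mult_minus crossp_minus)
  have "C *v u = (mat_commutator A B - mat_scale (dotp v g - dotp w f) (mat 1)) *v u" for u
  proof -
    have "C *v u = (A *v (B *v u) - dotp u g *s v - crossp f (crossp w u))
        - (B *v (A *v u) - dotp u f *s w - crossp g (crossp v u))"
      using oct_der_apply[OF C, of 0 u 0]
      by (simp add: fun_commutator_def app oct_diff oct_eq_iff[OF card] vector_smult_lneg)
    also have "\<dots> = A *v (B *v u) - B *v (A *v u) - (dotp v g - dotp w f) *s u"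
      by (simp add: vec_eq_iff forall_3 dotp_def crossp_def algebra_simps)
    also have "\<dots> = (mat_commutator A B - mat_scale (dotp v g - dotp w f) (mat 1)) *v u"
      by (simp add: mat_commutator_def matrix_vector_mult_diff_rdistrib matrix_vector_mul_assoc)
        (simp add: vec_eq_iff forall_3 matrix_vector_mult_def mat_scale_def mat_def sum_3)
    finally show ?thesis .
  qed
  then have "C = mat_commutator A B - mat_scale (dotp v g - dotp w f) (mat 1)"
    by (simp add: matrix_eq)
  \<comment> \<open>The two orders of composition contribute the same cross product, and 2 = -1
    gives its sign.\<close>
  moreover have "p = A *v w - B *v v + (crossp f g + crossp f g)"
    unfolding p crossp_anti[of f g] by (simp only: group)
  moreover have "- q = - (f v* B) + g v* A + (crossp v w + crossp v w)"
    unfolding q crossp_anti[of v w] by (simp only: group)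
  then have "- q = - (f v* B - g v* A + crossp v w)"
    unfolding double by (simp only: group)
  ultimately show ?thesis
    using C unfolding double neg_equal_iff_equal by simp
qed

section \<open>Splittings over the outer derivations\<close>

definition mat_unit :: "'n \<Rightarrow> 'n \<Rightarrow> 'k::zero_neq_one^'n^'n" where
  "mat_unit i j = (\<chi> a b. if a = i \<and> b = j then 1 else 0)"

lemma mat_unit_in_sl3: "i \<noteq> j \<Longrightarrow> mat_unit i j \<in> sl3"
  by (auto simp: sl3_def trace_def mat_unit_def intro!: sum.neutral)

lemma sl3_mat_1: "(3 :: 'k::field) = 0 \<Longrightarrow> mat_scale c (mat 1 :: 'k^3^3) \<in> sl3"
  by (simp add: sl3_def trace_def sum_3 mat_scale_def mat_def)

text \<open>The commutator is diag(1, 1, -2), and -2 = 1.\<close>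

lemma regular_nilpotent_commutator:
  assumes "(3 :: 'k::field) = 0"
  shows "mat_commutator (mat_unit 1 2 + mat_unit 2 3) (mat_unit 2 1 + mat_scale 2 (mat_unit 3 2)) =
    (mat 1 :: 'k^3^3)"
  by (simp add: vec_eq_iff forall_3 mat_commutator_nth sum_3 mat_unit_def mat_def mat_scale_def
      two_char_3[OF assms])

text \<open>For \<open>m = 0\<close> and \<open>m = - 1\<close> every product in the last equation
  vanishes. For \<open>m = 1\<close> there remain x2 = +-x1 and q2 = +-q1, which the last two
  equations exclude together.\<close>

lemma field_card_3_no_solution:
  fixes m x1 x2 p1 p2 y1 y2 q1 q2 :: "'k::field"
  assumes card: "CARD('k) = 3"
    and x: "m * p2 * p2 = p1 * p1" "p1 = m * x1 * x1 - x2 * x2" "x2 * p1 + m * x1 * p2 = 0"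
    and y: "m * y1 * y1 = y2 * y2" "y2 = q1 * q1 - m * q2 * q2" "y2 * q1 + m * y1 * q2 = 0"
    and xy: "m * (x1 * q1 + x2 * q2) = m * (y1 * p1 + y2 * p2)"
      "x2 * q1 + m * x1 * q2 + y2 * p1 + m * y1 * p2 = - 1"
  shows False
proof -
  note [simp] = field_card_3(1)[OF card] two_char_3[OF field_card_3(1)[OF card]]
  note cases = field_card_3(2)[OF card]
  have [simp]: "(1 :: 'k) \<noteq> - 1" "(- 1 :: 'k) \<noteq> 1"
    using one_add_one[where 'a = 'k] by (metis add.right_inverse two_char_3
        field_card_3(1)[OF card] zero_neq_one)+
  have X: "x2 = 0" "p1 = 0" if "m = 0"
    using x that by simp_all
  have Y: "y2 = 0" "q1 = 0" if "m = 0"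
    using y that by simp_all
  have X1: "p1 = 0 \<and> p2 = 0 \<and> x1 * x1 = x2 * x2" if "m = 1"
    using x cases[of x1] cases[of x2] cases[of p2] that by (elim disjE) simp_all
  have Y1: "y1 = 0 \<and> y2 = 0 \<and> q1 * q1 = q2 * q2" if "m = 1"
    using y cases[of q1] cases[of q2] cases[of y1] that by (elim disjE) simp_all
  \<comment> \<open>As -1 is not a square, a vanishing sum of two squares has both terms
    zero.\<close>
  have X2: "p1 = 0 \<and> p2 = 0 \<and> x1 = 0 \<and> x2 = 0" if "m = - 1"
    using x cases[of x1] cases[of x2] cases[of p2] that by (elim disjE) simp_all
  show False
    using cases[of m]
  proof (elim disjE)
    assume "m = 0"
    with X Y xy(2) show False
      by simp
  next
    assume m: "m = 1"
    with X1 Y1 xy cases[of x1] cases[of x2] cases[of q1] cases[of q2] show False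
      by (elim disjE) simp_all
  next
    assume "m = - 1"
    with X2 xy(2) y cases[of y1] show False
      by simp
  qed
qed

text \<open>The conditions say that \<open>X \<mapsto> (X - \<alpha> X \<cdot> mat 1) + ad (0, v X, f X)\<close> is a Lie algebra homomorphism
  from \<open>sl3\<close> to the derivations that kills the center, that is, a splitting of the extension of
  \<open>psl3\<close> (outer derivations) by \<open>psl3\<close> (inner derivations).\<close>
definition psl3_lift ::
  "('k::field^3^3 \<Rightarrow> 'k) \<Rightarrow> ('k^3^3 \<Rightarrow> 'k^3) \<Rightarrow> ('k^3^3 \<Rightarrow> 'k^3) \<Rightarrow> bool" where
  "psl3_lift \<alpha> v f \<longleftrightarrow>
     (\<forall>X\<in>sl3. \<forall>Y\<in>sl3. \<alpha> (X + Y) = \<alpha> X + \<alpha> Y \<and> v (X + Y) = v X + v Y \<and> f (X + Y) = f X + f Y) \<and>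
     (\<forall>c. \<forall>X\<in>sl3. \<alpha> (mat_scale c X) = c * \<alpha> X \<and> v (mat_scale c X) = c *s v X \<and>
       f (mat_scale c X) = c *s f X) \<and>
     \<alpha> (mat 1) = 1 \<and> v (mat 1) = 0 \<and> f (mat 1) = 0 \<and>
     (\<forall>X\<in>sl3. \<forall>Y\<in>sl3.
       \<alpha> (mat_commutator X Y) = dotp (v X) (f Y) - dotp (v Y) (f X) \<and>
       v (mat_commutator X Y) = (X *v v Y - \<alpha> X *s v Y) - (Y *v v X - \<alpha> Y *s v X)
         - crossp (f X) (f Y) \<and>
       f (mat_commutator X Y) = (f X v* Y - \<alpha> Y *s f X) - (f Y v* X - \<alpha> X *s f Y)
         + crossp (v X) (v Y))"

context
  fixes \<alpha> :: "'k::field^3^3 \<Rightarrow> 'k" and v f :: "'k^3^3 \<Rightarrow> 'k^3"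
  assumes lift: "psl3_lift \<alpha> v f"
begin

lemma lift_add: "X \<in> sl3 \<Longrightarrow> Y \<in> sl3 \<Longrightarrow> \<alpha> (X + Y) = \<alpha> X + \<alpha> Y"
    "X \<in> sl3 \<Longrightarrow> Y \<in> sl3 \<Longrightarrow> v (X + Y) = v X + v Y"
    "X \<in> sl3 \<Longrightarrow> Y \<in> sl3 \<Longrightarrow> f (X + Y) = f X + f Y"
  and lift_scale: "X \<in> sl3 \<Longrightarrow> \<alpha> (mat_scale c X) = c * \<alpha> X"
    "X \<in> sl3 \<Longrightarrow> v (mat_scale c X) = c *s v X" "X \<in> sl3 \<Longrightarrow> f (mat_scale c X) = c *s f X"
  and lift_1: "\<alpha> (mat 1) = 1" "v (mat 1) = 0" "f (mat 1) = 0"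
  and lift_commutator: "X \<in> sl3 \<Longrightarrow> Y \<in> sl3 \<Longrightarrow>
      \<alpha> (mat_commutator X Y) = dotp (v X) (f Y) - dotp (v Y) (f X)"
    "X \<in> sl3 \<Longrightarrow> Y \<in> sl3 \<Longrightarrow> v (mat_commutator X Y) =
      (X *v v Y - \<alpha> X *s v Y) - (Y *v v X - \<alpha> Y *s v X) - crossp (f X) (f Y)"
    "X \<in> sl3 \<Longrightarrow> Y \<in> sl3 \<Longrightarrow> f (mat_commutator X Y) =
      (f X v* Y - \<alpha> Y *s f X) - (f Y v* X - \<alpha> X *s f Y) + crossp (v X) (v Y)"
  using lift by (simp_all add: psl3_lift_def)

lemma lift_0: "\<alpha> 0 = 0" "v 0 = 0" "f 0 = 0"
  using lift_scale[of 0 0] sl3.carrier_closed(1) by simp_all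

lemma lift_minus:
  assumes "X \<in> sl3"
  shows "\<alpha> (- X) = - \<alpha> X" "v (- X) = - v X" "f (- X) = - f X"
  using lift_scale[OF assms, of "- 1"] by (simp_all add: vec_eq_iff)

text \<open>For \<open>A\<close> in the common kernel only its natural action survives in the
  relations: \<open>v\<close> and \<open>f\<close> turn commutators with \<open>A\<close> into the
  actions of \<open>A\<close> on \<open>V\<close> and on its dual.\<close>

lemma lift_commutator_kernel:
  assumes "A \<in> sl3" "\<alpha> A = 0" "v A = 0" "f A = 0" "X \<in> sl3"
  shows "\<alpha> (mat_commutator A X) = 0" "v (mat_commutator A X) = A *v v X"
    "f (mat_commutator A X) = - (f X v* A)"
  using assms lift_commutator[of A X]
  by (simp_all add: dotp_def crossp_def vec_eq_iff[of "vector _"] forall_3)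

lemma kernel_not_regular_nilpotent:
  assumes three: "(3 :: 'k) = 0" and A: "A = mat_unit 1 2 + mat_unit 2 3"
    and ker: "\<alpha> A = 0" "v A = 0" "f A = 0"
  shows False
proof -
  have sl: "A \<in> sl3" "mat_unit 2 1 + mat_scale 2 (mat_unit 3 2) \<in> (sl3 :: ('k^3^3) set)"
    by (auto simp: A mat_unit_in_sl3 sl3.carrier_closed)
  show False
    using lift_commutator_kernel(1)[OF sl(1) ker sl(2)] lift_1
    by (simp add: A regular_nilpotent_commutator[OF three])
qed

text \<open>Bracketing with \<open>A\<close> takes E23 to E13 and E31 to -E32, so the values at E23
  and E31 determine the other two, and the relations among the four become the system of
  \<open>field_card_3_no_solution\<close>.\<close>

lemma kernel_not_block:
  assumes card: "CARD('k) = 3"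
    and A: "A = mat_unit 1 2 + mat_scale m (mat_unit 2 1)"
    and ker: "\<alpha> A = 0" "v A = 0" "f A = 0"
  shows False
proof -
  note [simp] = field_card_3(1)[OF card] two_char_3[OF field_card_3(1)[OF card]]
  define X where "X = v (mat_unit 2 3)"
  define X' where "X' = f (mat_unit 2 3)"
  define Y where "Y = v (mat_unit 3 1)"
  define Y' where "Y' = f (mat_unit 3 1)"
  have sl: "A \<in> sl3"
    by (auto simp: A mat_unit_in_sl3 sl3.carrier_closed)
  note kc = lift_commutator_kernel[OF sl ker]
  have c: "mat_commutator A (mat_unit 2 3) = mat_unit 1 3"
    "mat_commutator A (mat_unit 3 1) = - mat_unit 3 2"
    "mat_commutator (mat_unit 1 3 :: 'k^3^3) (mat_unit 2 3) = 0"
    "mat_commutator (mat_unit 3 1 :: 'k^3^3) (mat_unit 3 2) = 0"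
    "mat_commutator (mat_unit 3 1 :: 'k^3^3) (mat_unit 1 3) = mat 1 + mat_commutator A (mat_unit 2 1)"
    "mat_commutator (mat_unit 1 3 :: 'k^3^3) (mat_unit 3 2) = mat_unit 1 2"
    by (simp_all add: A vec_eq_iff forall_3 mat_commutator_nth sum_3 mat_unit_def mat_def mat_scale_def)
  have v13: "v (mat_unit 1 3) = A *v X" and f13: "f (mat_unit 1 3) = - (X' v* A)"
    and a13: "\<alpha> (mat_unit 1 3) = 0"
    using kc[of "mat_unit 2 3"] by (simp_all add: c mat_unit_in_sl3 X_def X'_def)
  have v32: "v (mat_unit 3 2) = - (A *v Y)" and f32: "f (mat_unit 3 2) = Y' v* A"
    and a32: "\<alpha> (mat_unit 3 2) = 0"
    using kc[of "mat_unit 3 1"] minus_equation_iff[of "v (mat_unit 3 2)" "A *v Y"]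
    by (auto simp: c mat_unit_in_sl3 lift_minus Y_def Y'_def)
  define z where "z = \<alpha> (mat_unit 2 3)"
  define u where "u = \<alpha> (mat_unit 3 1)"
  note defs = X_def[symmetric] X'_def[symmetric] Y_def[symmetric] Y'_def[symmetric]
    z_def[symmetric] u_def[symmetric]
  note vals = v13 f13 a13 v32 f32 a32 c mat_unit_in_sl3 lift_0 matrix_vector_mult_minus dotp_minus
    crossp_minus defs
  note coords = A vec_eq_iff forall_3 dotp_def crossp_def matrix_vector_mult_def
    vector_matrix_mult_def sum_3 mat_unit_def mat_scale_def
  have e1: "dotp (A *v X) X' + dotp X (X' v* A) = 0"
    using lift_commutator(1)[of "mat_unit 1 3" "mat_unit 2 3"] by (simp add: vals)
  have e2: "mat_unit 1 3 *v X - (mat_unit 2 3 *v (A *v X) - z *s (A *v X)) + crossp (X' v* A) X' = 0"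
    using lift_commutator(2)[of "mat_unit 1 3" "mat_unit 2 3"] by (simp add: vals)
  have e3: "- (X' v* A v* mat_unit 2 3 - z *s (X' v* A)) - X' v* mat_unit 1 3 + crossp (A *v X) X = 0"
    using lift_commutator(3)[of "mat_unit 1 3" "mat_unit 2 3"] by (simp add: vals)
  have e4: "dotp Y (Y' v* A) + dotp (A *v Y) Y' = 0"
    using lift_commutator(1)[of "mat_unit 3 1" "mat_unit 3 2"] by (simp add: vals)
  have e5: "- (mat_unit 3 1 *v (A *v Y) - u *s (A *v Y)) - mat_unit 3 2 *v Y - crossp Y' (Y' v* A) = 0"
    using lift_commutator(2)[of "mat_unit 3 1" "mat_unit 3 2"] by (simp add: vals)
  have e6: "Y' v* mat_unit 3 2 - (Y' v* A v* mat_unit 3 1 - u *s (Y' v* A)) - crossp Y (A *v Y) = 0"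
    using lift_commutator(3)[of "mat_unit 3 1" "mat_unit 3 2"] by (simp add: vals)
  \<comment> \<open>The commutator is the identity plus
    \<open>mat_commutator A (mat_unit 2 1)\<close>; \<alpha> is 1 on the first summand and 0 on the
    second.\<close>
  have e7: "- dotp Y (X' v* A) - dotp (A *v X) Y' = 1"
    using lift_commutator(1)[of "mat_unit 3 1" "mat_unit 1 3"] kc(1)[of "mat_unit 2 1"] sl
    by (simp add: vals lift_add sl3.br_closed lift_1 sl3_mat_1[of 1, simplified])
  have e8: "dotp (A *v X) (Y' v* A) - dotp (A *v Y) (X' v* A) = \<alpha> (mat_unit 1 2)"
    using lift_commutator(1)[of "mat_unit 1 3" "mat_unit 3 2"] by (simp add: vals)
  \<comment> \<open>This expresses E12 through \<open>A\<close> and a commutator with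
    \<open>A\<close>, on both of which \<alpha> vanishes.\<close>
  have "mat_commutator A (mat_commutator A (mat_unit 2 1)) + A = - mat_unit 1 2"
    by (simp add: A vec_eq_iff forall_3 mat_commutator_nth sum_3 mat_unit_def mat_scale_def)
  then have "\<alpha> (mat_unit 1 2) = 0"
    using lift_add(1)[of "mat_commutator A (mat_commutator A (mat_unit 2 1))" A] sl ker
      kc(1)[of "mat_commutator A (mat_unit 2 1)"] lift_minus(1)[of "mat_unit 1 2"]
    by (simp add: sl3.br_closed mat_unit_in_sl3)
  note e8 = e8[unfolded this]
  show False
  \<comment> \<open>The vector equations enter through their third coordinates, which involve
    neither \<open>z\<close> nor \<open>u\<close> nor the third coordinates of the four
    vectors.\<close>
  proof (rule field_card_3_no_solution[OF card])
    show "m * X' $ 2 * X' $ 2 = X' $ 1 * X' $ 1"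
      using e2 by (simp add: coords ac_simps)
    show "X' $ 1 = m * X $ 1 * X $ 1 - X $ 2 * X $ 2"
      using e3 by (simp add: coords ac_simps add_eq_0_iff2)
    show "X $ 2 * X' $ 1 + m * X $ 1 * X' $ 2 = 0"
      using e1 by (simp add: coords ac_simps add_eq_0_iff)
    show "m * Y $ 1 * Y $ 1 = Y $ 2 * Y $ 2"
      using e6 by (simp add: coords ac_simps)
    show "Y $ 2 = Y' $ 1 * Y' $ 1 - m * Y' $ 2 * Y' $ 2"
      using e5 by (simp add: coords ac_simps)
    show "Y $ 2 * Y' $ 1 + m * Y $ 1 * Y' $ 2 = 0"
      using e4 by (simp add: coords ac_simps add_eq_0_iff)
    show "m * (X $ 1 * Y' $ 1 + X $ 2 * Y' $ 2) = m * (Y $ 1 * X' $ 1 + Y $ 2 * X' $ 2)"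
      using e8 by (simp add: coords algebra_simps)
    show "X $ 2 * Y' $ 1 + m * X $ 1 * Y' $ 2 + Y $ 2 * X' $ 1 + m * Y $ 1 * X' $ 2 = - 1"
      using e7 by (simp add: coords) algebra
  qed
qed

end

text \<open>The cross product is only equivariant up to \<open>det G\<close>; the sign \<open>s\<close> makes up for it.\<close>
lemma psl3_lift_conj:
  fixes G G' :: "'k::field^3^3"
  assumes lift: "psl3_lift \<alpha> v f" and G: "G ** G' = mat 1" and s: "s = det G" "s * s = 1"
  shows "psl3_lift (\<lambda>X. \<alpha> (G ** X ** G')) (\<lambda>X. s *s (G' *v v (G ** X ** G')))
    (\<lambda>X. s *s (f (G ** X ** G') v* G))"
proof -
  have G': "G' ** G = mat 1"
    using G by (simp add: matrix_left_right_inverse)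
  have inv: "G' *v (G *v x) = x" "G *v (G' *v x) = x" "y v* G v* G' = y" "y v* G' v* G = y" for x y
    by (simp_all add: matrix_vector_mul_assoc vector_matrix_mul_assoc G G')
  have s': "det G' = s"
  proof -
    have "s * det G' = 1"
      using arg_cong[OF G, of det] by (simp add: det_mul s(1))
    then show ?thesis
      using s(2) by (metis mult.assoc mult.right_neutral mult_1)
  qed
  define K where "K X = G ** X ** G'" for X
  have K: "K X \<in> sl3" if "X \<in> sl3" for X
    using that trace_mul_sym[of G "X ** G'"] by (simp add: K_def sl3_def G' flip: matrix_mul_assoc)
  have K_add: "K (X + Y) = K X + K Y" and K_scale: "K (mat_scale c X) = mat_scale c (K X)"
    and K1: "K (mat 1) = mat 1" for X Y c
    by (simp_all add: K_def G matrix_add_ldistrib matrix_mult_distrib matrix_mult_scale)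
  have K_mult: "K X ** K Y = K (X ** Y)" for X Y
  proof -
    have "Z ** G' ** G = Z" for Z :: "'k^3^3"
      by (simp add: G' flip: matrix_mul_assoc)
    then show ?thesis
      by (simp add: K_def matrix_mul_assoc)
  qed
  have K_com: "K (mat_commutator X Y) = mat_commutator (K X) (K Y)" for X Y
    unfolding mat_commutator_def K_mult by (simp add: K_def matrix_mult_distrib)
  have KG: "G' *v (K X *v x) = X *v (G' *v x)" "(y v* K X) v* G = y v* G v* X" for X x y
    by (simp_all add: K_def inv flip: matrix_vector_mul_assoc vector_matrix_mul_assoc)
  have "G' *v crossp x y = s *s crossp (x v* G) (y v* G)" for x y
    using arg_cong[OF crossp_transform(1)[of G x y], of "\<lambda>z. s *s (G' *v z)"]
    by (simp add: inv vector_scalar_commute s(2) flip: s(1))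
  moreover have "crossp x y v* G = s *s crossp (G' *v x) (G' *v y)" for x y
    using arg_cong[OF crossp_transform(2)[of G' x y], of "\<lambda>z. s *s (z v* G)"]
    by (simp add: inv scalar_vector_matrix_assoc s(2) s')
  ultimately have cr: "s *s (G' *v crossp x y) = crossp (s *s (x v* G)) (s *s (y v* G))"
    "s *s (crossp x y v* G) = crossp (s *s (G' *v x)) (s *s (G' *v y))" for x y
    using s(2) by (simp_all add: crossp_scale)
  have ss: "s * (s * x) = x" for x
    using s(2) by (simp flip: mult.assoc)
  note L = lift_add[OF lift] lift_scale[OF lift] lift_1[OF lift] lift_commutator[OF lift]
  show ?thesis
    unfolding psl3_lift_def K_def[symmetric]
    by (intro conjI ballI allI)
      (simp_all add: K K_add K_scale K1 K_com L KG cr dotp_scale dotp_transform inv ss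
        vector_add_ldistrib vector_ssub_ldistrib matrix_vector_right_distrib
        matrix_vector_mult_diff_distrib vector_matrix_left_distrib vector_matrix_mult_diff_distrib
        vector_scalar_commute scalar_vector_matrix_assoc mult.commute)
qed

section \<open>Normal form of singular trace-zero matrices\<close>

text \<open>The equation \<open>xz\<close> says that \<open>det N = 0\<close>. If \<open>p\<close>
  is nonzero, the first basis vector is cyclic and \<open>c\<close> decides between the two forms;
  otherwise the first two basis vectors span an invariant plane and
  \<open>x * z = 0\<close>.\<close>

lemma cyclic_normal_form:
  fixes x y z w p :: "'k::field"
  assumes three: "(3 :: 'k) = 0" and xz: "x * z + y * p = 0"
    and N: "N = vector [vector [0, x, y], vector [1, z, w], vector [0, p, - z]]"
  shows "\<exists>G :: 'k^3^3. det G \<noteq> 0 \<and>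
    ((\<exists>m. N ** G = G ** (mat_unit 1 2 + mat_scale m (mat_unit 2 1))) \<or>
     N ** G = G ** (mat_unit 1 2 + mat_unit 2 3))"
proof -
  note coords = N det_3 vec_eq_iff forall_3 sum_3 matrix_matrix_mult_def mat_unit_def mat_scale_def
  let ?Q = "\<lambda>G :: 'k^3^3. \<lambda>m. det G \<noteq> 0 \<and> N ** G = G ** (mat_unit 1 2 + mat_scale m (mat_unit 2 1))"
  let ?J = "\<lambda>G :: 'k^3^3. det G \<noteq> 0 \<and> N ** G = G ** (mat_unit 1 2 + mat_unit 2 3)"
  define c where "c = x + z * z + p * w" \<comment> \<open>\<open>N\<^sup>3 e = c N e\<close> for the first basis vector \<open>e\<close>\<close>
  consider (1) "p \<noteq> 0" "c \<noteq> 0" | (2) "p \<noteq> 0" "c = 0" | (3) "p = 0" "z = 0" "x \<noteq> 0"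
    | (4) "p = 0" "z = 0" "x = 0" "y = 0" | (5) "p = 0" "z = 0" "x = 0" "y \<noteq> 0"
    | (6) "p = 0" "z \<noteq> 0" "x = 0"
    using xz by fastforce
  then show ?thesis
  proof cases
    case 1
    \<comment> \<open>With \<open>e\<close> the first basis vector, the columns are
      \<open>N\<^sup>2 e\<close>, \<open>N e\<close> and \<open>N\<^sup>2 e - c e\<close>; the last
      lies in the kernel.\<close>
    let ?G = "vector [vector [x, 0, x - c], vector [z, 1, z], vector [p, 0, p]] :: 'k^3^3"
    have "det ?G = p * c"
      by (simp add: det_3 algebra_simps)
    then have "det ?G \<noteq> 0"
      using 1 by simp
    moreover have "N ** ?G = ?G ** (mat_unit 1 2 + mat_scale c (mat_unit 2 1))"
      using xz by (simp add: coords algebra_simps c_def)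
    ultimately have "?Q ?G c"
      by blast
    then show ?thesis
      by blast
  next
    case 2
    then have "?J (vector [vector [x, 0, 1], vector [z, 1, 0], vector [p, 0, 0]])"
      using xz by (auto simp: coords algebra_simps c_def)
    then show ?thesis
      by blast
  next
    case 3
    then have "?Q (vector [vector [0, 1, - w], vector [1, 0, - y / x], vector [0, 0, 1]]) x"
      by (auto simp: coords)
    then show ?thesis
      by blast
  next
    case 4
    then have "?Q (vector [vector [0, 1, - w], vector [1, 0, 0], vector [0, 0, 1]]) 0"
      by (auto simp: coords)
    then show ?thesis
      by blast
  next
    case 5
    then have "?J (vector [vector [0, y, 0], vector [y, w, 0], vector [0, 0, 1]])"
      by (auto simp: coords)
    then show ?thesis
      by blast
  next
    case 6
    define s where "s = - y / z"
    define t where "t = (w + s) / z" \<comment> \<open>\<open>(s, t, 1)\<close> is an eigenvector of \<open>N\<close> for \<open>- z\<close>\<close>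
    have y: "y = - z * s" and w: "w = z * t - s"
      using 6 by (simp_all add: s_def t_def)
    \<comment> \<open>The second column is a sum of eigenvectors for \<open>z\<close> and
      \<open>- z\<close>, the first is its image under \<open>N\<close>, the third spans the
      kernel.\<close>
    let ?G = "vector [vector [- z * s, s, - z], vector [z * (1 - t), 1 + t, 1],
        vector [- z, 1, 0]] :: 'k^3^3"
    have "det ?G = (1 - 3) * (z * z)"
      by (simp add: det_3 algebra_simps)
    then have "det ?G \<noteq> 0"
      using 6 three by simp
    moreover have "N ** ?G = ?G ** (mat_unit 1 2 + mat_scale (z * z) (mat_unit 2 1))"
      by (simp add: coords 6 y w) (simp add: algebra_simps three)
    ultimately have "?Q ?G (z * z)"
      by blast
    then show ?thesis
      by blast
  qed
qed

text \<open>Otherwise every nonzero vector is an eigenvector, so \<open>A\<close> is scalar, and a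
  scalar matrix with determinant 0 vanishes.\<close>

lemma exists_cyclic_pair:
  fixes A :: "'k::field^3^3"
  assumes "(3 :: 'k) = 0" "det A = 0" "A \<noteq> 0"
  obtains u where "crossp u (A *v u) \<noteq> 0"
proof (rule ccontr)
  assume "\<not> thesis"
  then have c: "crossp u (A *v u) = 0" for u
    using that by blast
  note coords = vec_eq_iff forall_3 matrix_vector_mult_def crossp_def sum_3
  have a: "A$2$1 = 0" "A$3$1 = 0"
    using c[of "vector [1,0,0]"] by (simp_all add: coords)
  have b: "A$1$2 = 0" "A$3$2 = 0"
    using c[of "vector [0,1,0]"] by (simp_all add: coords)
  have d: "A$1$3 = 0" "A$2$3 = 0"
    using c[of "vector [0,0,1]"] by (simp_all add: coords)
  have e: "A$1$1 = A$2$2" "A$2$2 = A$3$3"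
    using c[of "vector [1, 1, 0]"] c[of "vector [0, 1, 1]"] by (simp_all add: coords a b d)
  have "A$3$3 = 0"
    using \<open>det A = 0\<close> by (simp add: det_3 a b d e)
  then have "A = 0"
    by (simp add: vec_eq_iff forall_3 a b d e)
  with assms show False
    by simp
qed

lemma traceless_singular_normal_form:
  fixes A :: "'k::field^3^3"
  assumes three: "(3 :: 'k) = 0" and A: "det A = 0" "A \<in> sl3" "A \<noteq> 0"
  shows "\<exists>G :: 'k^3^3. det G \<noteq> 0 \<and>
    ((\<exists>m. A ** G = G ** (mat_unit 1 2 + mat_scale m (mat_unit 2 1))) \<or>
     A ** G = G ** (mat_unit 1 2 + mat_unit 2 3))"
proof -
  obtain u where u: "crossp u (A *v u) \<noteq> 0"
    using exists_cyclic_pair three A by blast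
  then obtain k where k: "crossp u (A *v u) $ k \<noteq> 0"
    by (auto simp: vec_eq_iff)
  \<comment> \<open>A basis starting with \<open>u\<close> and \<open>A *v u\<close>; the
    determinant is the nonzero coordinate \<open>k\<close> of their cross product.\<close>
  define M :: "'k^3^3" where
    "M = (\<chi> i j. if j = 1 then u $ i else if j = 2 then (A *v u) $ i else if i = k then 1 else 0)"
  have "det M = crossp u (A *v u) $ k"
    using exhaust_3[of k] by (auto simp: M_def det_3 crossp_def)
  with k have "invertible M"
    by (simp add: invertible_det_nz)
  then obtain M' where M: "M ** M' = mat 1" "M' ** M = mat 1"
    by (auto simp: invertible_def)
  define N where "N = M' ** A ** M"
  have AM: "A ** M = M ** N"
    by (metis M(1) N_def matrix_mul_assoc matrix_mul_lid)
  have tr: "N $ 1 $ 1 + N $ 2 $ 2 + N $ 3 $ 3 = 0"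
    using A(2) trace_mul_sym[of M' "A ** M"] M(1)
    by (simp add: N_def sl3_def trace_def sum_3 flip: matrix_mul_assoc)
  have "det N = 0"
    using A(1) by (simp add: N_def det_mul)
  have "(A ** M) $ j $ 1 = M $ j $ 2" for j
    by (simp add: matrix_matrix_mult_def matrix_vector_mult_def M_def)
  then have "N $ i $ 1 = (M' ** M) $ i $ 2" for i
    by (simp add: N_def matrix_matrix_mult_def[of M' "A ** M"] matrix_matrix_mult_def[of M' M]
        flip: matrix_mul_assoc)
  then have N1: "N $ 1 $ 1 = 0" "N $ 2 $ 1 = 1" "N $ 3 $ 1 = 0"
    by (simp_all add: M(2) mat_def)
  then have N33: "N $ 3 $ 3 = - N $ 2 $ 2"
    using tr by (simp add: add_eq_0_iff)
  have "N $ 1 $ 2 * N $ 2 $ 2 + N $ 1 $ 3 * N $ 3 $ 2 = 0"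
    using \<open>det N = 0\<close> by (simp add: det_3 N1 N33 add.commute)
  then obtain G :: "'k^3^3" where G: "det G \<noteq> 0"
      "(\<exists>m. N ** G = G ** (mat_unit 1 2 + mat_scale m (mat_unit 2 1))) \<or>
       N ** G = G ** (mat_unit 1 2 + mat_unit 2 3)"
    using cyclic_normal_form[OF three, of "N $ 1 $ 2" "N $ 2 $ 2" "N $ 1 $ 3" "N $ 3 $ 2" N "N $ 2 $ 3"]
    by (auto simp: vec_eq_iff forall_3 N1 N33)
  have "det (M ** G) \<noteq> 0"
    using G(1) \<open>invertible M\<close> by (simp add: det_mul invertible_det_nz)
  moreover have "A ** (M ** G) = M ** G ** P" if "N ** G = G ** P" for P
    using that AM by (metis matrix_mul_assoc)
  ultimately show ?thesis
    using G(2) by blast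
qed

section \<open>Nonexistence of splittings\<close>

lemma cayley_hamilton_sl3:
  fixes A :: "'k::field^3^3"
  assumes "A \<in> sl3"
  shows "A ** A ** A = mat_scale (A$1$2 * A$2$1 + A$1$3 * A$3$1 + A$2$3 * A$3$2
    - A$1$1 * A$2$2 - A$1$1 * A$3$3 - A$2$2 * A$3$3) A + mat_scale (det A) (mat 1)"
proof -
  have "A$3$3 = - A$1$1 - A$2$2"
    using assms by (simp add: sl3_def trace_def sum_3 add_eq_0_iff)
  then show ?thesis
    by (simp add: vec_eq_iff forall_3 matrix_matrix_mult_def sum_3 mat_scale_def mat_def det_3)
      (simp add: algebra_simps)
qed

text \<open>The mixed terms of the triple commutator carry the coefficient 3, so it is the
  commutator with \<open>A ** A ** A\<close>, whose scalar part drops out.\<close>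

lemma triple_commutator_char_3:
  fixes A X :: "'k::field^3^3"
  assumes three: "(3 :: 'k) = 0" and A: "A ** A ** A = mat_scale a A + mat_scale d (mat 1)"
  shows "mat_commutator A (mat_commutator A (mat_commutator A X)) = mat_scale a (mat_commutator A X)"
proof -
  have cancel: "Y + Y + Y = 0" for Y :: "'k^3^3"
    using three double_char_3[OF three] by (simp add: vec_eq_iff)
  have "mat_commutator A (mat_commutator A (mat_commutator A X)) =
      (A ** A ** A) ** X - X ** (A ** A ** A)
      - (A ** A ** X ** A + A ** A ** X ** A + A ** A ** X ** A)
      + (A ** X ** A ** A + A ** X ** A ** A + A ** X ** A ** A)"
    unfolding mat_commutator_def matrix_mult_distrib matrix_mul_assoc
    by (simp only: diff_conv_add_uminus minus_add_distrib minus_minus ac_simps)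
  also have "\<dots> = mat_scale a (mat_commutator A X)"
    unfolding cancel A
    by (simp add: mat_commutator_def matrix_mult_distrib matrix_add_ldistrib matrix_mult_scale
        mat_space.scale_right_diff_distrib)
  finally show ?thesis .
qed

context
  fixes \<alpha> :: "'k::field^3^3 \<Rightarrow> 'k" and v f :: "'k^3^3 \<Rightarrow> 'k^3"
  assumes card: "CARD('k) = 3" and lift: "psl3_lift \<alpha> v f"
begin

text \<open>Comparing the triple commutator with Cayley-Hamilton leaves
  \<open>det A *s v X = 0\<close>, and likewise for \<open>f\<close>. If \<open>v\<close> and
  \<open>f\<close> vanish, so does \<alpha> on commutators, one of which is the identity.\<close>

lemma kernel_singular:
  assumes A: "A \<in> sl3" and ker: "\<alpha> A = 0" "v A = 0" "f A = 0"
  shows "det A = 0"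
proof (rule ccontr)
  assume "det A \<noteq> 0"
  obtain a where "A ** A ** A = mat_scale a A + mat_scale (det A) (mat 1)"
    using cayley_hamilton_sl3[OF A] by blast
  note CH = this triple_commutator_char_3[OF field_card_3(1)[OF card] this]
  note kc = lift_commutator_kernel[OF lift A ker]
  have vf: "v X = 0" "f X = 0" if X: "X \<in> sl3" for X
  proof -
    have cl: "mat_commutator A X \<in> sl3" "mat_commutator A (mat_commutator A X) \<in> sl3"
      using A X by (simp_all add: sl3.br_closed)
    have "A ** A ** A *v v X = a *s (A *v v X)"
      using kc(2)[OF X] kc(2)[OF cl(1)] kc(2)[OF cl(2)] lift_scale(2)[OF lift cl(1), of a]
      by (simp add: CH(2) matrix_vector_mul_assoc matrix_mul_assoc)
    moreover have "A ** A ** A *v x = a *s (A *v x) + det A *s x" for x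
      unfolding CH(1) by (simp add: vec_eq_iff matrix_vector_mult_def mat_scale_def
          mat_def sum_3 forall_3 algebra_simps)
    ultimately show "v X = 0"
      using \<open>det A \<noteq> 0\<close> by simp
    have "- (f X v* A v* A v* A) = - (a *s (f X v* A))"
      using kc(3)[OF X] kc(3)[OF cl(1)] kc(3)[OF cl(2)] lift_scale(3)[OF lift cl(1), of a]
      by (simp only: CH(2) matrix_vector_mult_minus vector_smult_rneg minus_minus)
    then have "f X v* (A ** A ** A) = a *s (f X v* A)"
      by (simp add: vector_matrix_mul_assoc)
    moreover have "x v* (A ** A ** A) = a *s (x v* A) + det A *s x" for x
      unfolding CH(1) by (simp add: vec_eq_iff vector_matrix_mult_def mat_scale_def
          mat_def sum_3 forall_3 algebra_simps)
    ultimately show "f X = 0"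
      using \<open>det A \<noteq> 0\<close> by simp
  qed
  have "mat_unit 1 2 + mat_unit 2 3 \<in> (sl3 :: ('k^3^3) set)"
    "mat_unit 2 1 + mat_scale 2 (mat_unit 3 2) \<in> (sl3 :: ('k^3^3) set)"
    by (auto simp: mat_unit_in_sl3 sl3.carrier_closed)
  from lift_commutator(1)[OF lift this] show False
    using regular_nilpotent_commutator[OF field_card_3(1)[OF card]] lift_1[OF lift] vf
    by (simp add: mat_unit_in_sl3 sl3.carrier_closed dotp_def)
qed

lemma kernel_trivial:
  assumes A: "A \<in> sl3" and ker: "\<alpha> A = 0" "v A = 0" "f A = 0"
  shows "A = 0"
proof (rule ccontr)
  assume "A \<noteq> 0"
  then obtain G and P :: "'k^3^3" where "det G \<noteq> 0" and AG: "A ** G = G ** P"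
    and P: "(\<exists>m. P = mat_unit 1 2 + mat_scale m (mat_unit 2 1)) \<or> P = mat_unit 1 2 + mat_unit 2 3"
    using traceless_singular_normal_form[OF field_card_3(1)[OF card] kernel_singular[OF A ker] A]
    by blast
  then obtain G' where G: "G ** G' = mat 1"
    by (auto simp: invertible_def simp flip: invertible_det_nz)
  \<comment> \<open>Here \<open>det G\<close> is 1 or -1, so it can serve as the sign in
    \<open>psl3_lift_conj\<close>.\<close>
  have "det G * det G = 1"
    using field_card_3(2)[OF card, of "det G"] \<open>det G \<noteq> 0\<close> by auto
  note lift' = psl3_lift_conj[OF lift G refl this]
  have GPG: "G ** P ** G' = A"
    using AG G by (metis matrix_mul_assoc matrix_mul_rid)
  from P show False
  proof (elim disjE exE)
    fix m assume "P = mat_unit 1 2 + mat_scale m (mat_unit 2 1)"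
    from kernel_not_block[OF lift' card this] show False
      by (simp add: GPG ker)
  next
    assume "P = mat_unit 1 2 + mat_unit 2 3"
    from kernel_not_regular_nilpotent[OF lift' field_card_3(1)[OF card] this] show False
      by (simp add: GPG ker)
  qed
qed

text \<open>A trivial kernel would embed the 8-dimensional \<open>sl3\<close> into the 7-dimensional
  space of triples; the dimensions are compared by counting elements.\<close>

lemma no_psl3_lift: False
proof -
  let ?M = "\<lambda>((a, b), x :: 'k^3, y :: 'k^3).
    vector [vector [a, x $ 1, x $ 2], vector [x $ 3, b, y $ 1], vector [y $ 2, y $ 3, - a - b]] :: 'k^3^3"
  have "finite (UNIV :: ('k^3^3) set)"
    by (rule card_ge_0_finite) (simp add: card)
  then have "finite (sl3 :: ('k^3^3) set)"
    by (rule finite_subset[OF subset_UNIV])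
  have "3 ^ 8 = CARD(('k \<times> 'k) \<times> ('k^3) \<times> ('k^3))"
    by (simp add: card)
  also have "\<dots> = card (range ?M)"
    by (intro card_image[symmetric] injI) (auto simp: vec_eq_iff forall_3)
  also have "\<dots> \<le> card (sl3 :: ('k^3^3) set)"
    using \<open>finite sl3\<close> by (intro card_mono) (auto simp: sl3_def trace_def sum_3)
  finally have sl: "3 ^ 8 \<le> card (sl3 :: ('k^3^3) set)" .
  let ?F = "\<lambda>X. (\<alpha> X, v X, f X)"
  have "inj_on ?F sl3"
  proof (rule inj_onI)
    fix X Y assume "X \<in> sl3" "Y \<in> sl3" "?F X = ?F Y"
    then have "X - Y = 0"
      using kernel_trivial[of "X - Y"] lift_add[OF lift, of X "- Y"] lift_minus[OF lift, of Y]
      by (simp add: sl3.carrier_closed)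
    then show "X = Y"
      by simp
  qed
  moreover have "finite (UNIV :: ('k \<times> ('k^3) \<times> ('k^3)) set)"
    by (rule card_ge_0_finite) (simp add: card)
  ultimately have "card (sl3 :: ('k^3^3) set) \<le> CARD('k \<times> ('k^3) \<times> ('k^3))"
    by (intro card_inj_on_le[where f = ?F]) simp_all
  also have "\<dots> = 3 ^ 7"
    by (simp add: card card_cartesian_product)
  finally show False
    using sl by simp
qed

end

section \<open>From a homomorphism that is not inner to a splitting\<close>

theorem proposition4p6:
  assumes "CARD('k::field) = 3"
  shows "taut psl3_scale (UNIV :: 'k psl3 set) psl3_bracket"
  unfolding taut_def
proof (intro allI impI, rule ccontr)
  note card = assms
  note eq_iff = psl3_abs_eq_iff[OF card]
  fix \<phi> :: "'k psl3 \<Rightarrow> 'k psl3 \<Rightarrow> 'k psl3"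
  assume hom: "lie_hom psl3_scale UNIV psl3_bracket (fun_scale psl3_scale)
      (Der psl3_scale UNIV psl3_bracket) fun_commutator \<phi>"
    and outer: "\<not> range \<phi> \<subseteq> Inn UNIV psl3_bracket"
  have Der: "\<phi> x \<in> Der psl3_scale UNIV psl3_bracket"
    and \<phi>_add: "\<phi> (x + y) = \<phi> x + \<phi> y"
    and \<phi>_scale: "\<phi> (psl3_scale c x) = fun_scale psl3_scale c (\<phi> x)"
    and \<phi>_br: "\<phi> (psl3_bracket x y) = fun_commutator (\<phi> x) (\<phi> y)" for x y c
    using hom by (auto simp: lie_hom_def)
  obtain A v f where der: "oct_der (\<phi> x) (A x) (v x) (f x)" for x
    using Der_oct_der[OF card Der] by metis
  note uniq = oct_der_unique[OF card der]
  have add: "A (x + y) = A x + A y" "v (x + y) = v x + v y" "f (x + y) = f x + f y" for x y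
    using uniq[of "x + y"] oct_der_add[OF der[of x] der[of y]] unfolding \<phi>_add by blast+
  have scale: "A (psl3_scale c x) = mat_scale c (A x)" "v (psl3_scale c x) = c *s v x"
    "f (psl3_scale c x) = c *s f x" for c x
    using uniq[of "psl3_scale c x"] oct_der_scale[OF der[of x]] unfolding \<phi>_scale by blast+
  have br: "A (psl3_bracket x y) = mat_commutator (A x) (A y)
      - mat_scale (dotp (v x) (f y) - dotp (v y) (f x)) (mat 1)"
    "v (psl3_bracket x y) = A x *v v y - A y *v v x - crossp (f x) (f y)"
    "f (psl3_bracket x y) = f x v* A y - f y v* A x + crossp (v x) (v y)" for x y
    using uniq[of "psl3_bracket x y"] oct_der_commutator[OF card Der[of x] der[of x] Der[of y] der[of y]]
    unfolding \<phi>_br by blast+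
  have sl: "A x \<in> sl3" for x
    using oct_der_sl3[OF der] .
  \<comment> \<open>By \<open>oct_der_inner\<close>, \<phi> is inner on \<open>J\<close>. As
    \<open>J\<close> is an ideal and \<phi> is not inner everywhere, simplicity gives
    \<open>J = 0\<close>.\<close>
  define J where "J = {x. \<exists>c. A x = mat_scale c (mat 1)}"
  have J_0: "x = 0" if x: "x \<in> J" for x
  proof (rule ccontr)
    assume "x \<noteq> 0"
    have "y \<in> J" for y
    proof (rule psl3_ideal[OF card _ _ _ x \<open>x \<noteq> 0\<close>])
      show "x + y \<in> J" if "x \<in> J" "y \<in> J" for x y
        using that by (auto simp: J_def add simp flip: mat_space.scale_left_distrib)
      show "psl3_scale c x \<in> J" if "x \<in> J" for c x
        using that by (auto simp: J_def scale)
      show "psl3_bracket x y \<in> J" if "x \<in> J" for x y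
        using that by (auto simp: J_def br scalar_commutator simp flip: mat_space.scale_minus_left)
    qed
    then have "\<phi> y \<in> Inn UNIV psl3_bracket" for y
      using der[of y] oct_der_inner[OF card] by (auto simp: J_def) metis
    with outer show False
      by auto
  qed
  have inj: "x = y" if "A x - A y = mat_scale c (mat 1)" for x y c
  proof -
    have "A (x - y) = A x - A y"
      using add(1)[of "x - y" y] by simp
    with that have "x - y \<in> J"
      by (auto simp: J_def)
    from J_0[OF this] show ?thesis
      by simp
  qed
  \<comment> \<open>Modulo scalars \<open>A\<close> is an injective endomap of a finite set, hence
    onto. Its inverse gives \<xi>, and \<alpha> records the scalar by which representatives
    differ.\<close>
  have "inj (\<lambda>x. abs_psl3 (A x))"
    using inj by (intro injI) (auto simp: eq_iff sl)
  then have "surj (\<lambda>x. abs_psl3 (A x))"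
    by (rule finite_UNIV_inj_surj[OF finite_psl3[OF card]])
  then have "\<exists>x c. A x = X - mat_scale c (mat 1)" if "X \<in> sl3" for X
  proof -
    obtain x where "abs_psl3 X = abs_psl3 (A x)"
      using \<open>surj _\<close> by (metis surjD)
    then show ?thesis
      using that by (auto simp: eq_iff sl algebra_simps)
  qed
  then obtain \<xi> \<alpha> where \<xi>: "X \<in> sl3 \<Longrightarrow> A (\<xi> X) = X - mat_scale (\<alpha> X) (mat 1)" for X
    by metis
  \<comment> \<open>As \<xi> and \<alpha> are determined uniquely, each law for them follows by
    exhibiting a solution.\<close>
  have lift: "\<xi> X = x \<and> \<alpha> X = c" if "X \<in> sl3" "A x = X - mat_scale c (mat 1)" for X x c
  proof -
    have "A (\<xi> X) - A x = mat_scale (c - \<alpha> X) (mat 1)"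
      using that by (simp add: \<xi> mat_space.scale_left_diff_distrib)
    then have "\<xi> X = x"
      by (rule inj)
    moreover have "(mat 1 :: 'k^3^3) \<noteq> 0"
      by (simp add: vec_eq_iff forall_3 mat_def)
    ultimately show ?thesis
      using \<xi>[OF that(1)] that(2) by simp
  qed
  have "psl3_lift \<alpha> (\<lambda>X. v (\<xi> X)) (\<lambda>X. f (\<xi> X))"
  proof -
    have l_add: "\<xi> (X + Y) = \<xi> X + \<xi> Y" "\<alpha> (X + Y) = \<alpha> X + \<alpha> Y"
      if "X \<in> sl3" "Y \<in> sl3" for X Y
      using lift[of "X + Y" "\<xi> X + \<xi> Y" "\<alpha> X + \<alpha> Y"] that
      by (simp_all add: sl3.carrier_closed add \<xi> mat_space.scale_left_distrib)
    have l_scale: "\<xi> (mat_scale c X) = psl3_scale c (\<xi> X)" "\<alpha> (mat_scale c X) = c * \<alpha> X"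
      if "X \<in> sl3" for c X
      using lift[of "mat_scale c X" "psl3_scale c (\<xi> X)" "c * \<alpha> X"] that
      by (simp_all add: sl3.carrier_closed scale \<xi> mat_space.scale_right_diff_distrib)
    have l_br: "\<xi> (mat_commutator X Y) = psl3_bracket (\<xi> X) (\<xi> Y)"
      "\<alpha> (mat_commutator X Y) = dotp (v (\<xi> X)) (f (\<xi> Y)) - dotp (v (\<xi> Y)) (f (\<xi> X))"
      if "X \<in> sl3" "Y \<in> sl3" for X Y
      using lift[of "mat_commutator X Y" "psl3_bracket (\<xi> X) (\<xi> Y)"
          "dotp (v (\<xi> X)) (f (\<xi> Y)) - dotp (v (\<xi> Y)) (f (\<xi> X))"] that
      by (simp_all add: sl3.br_closed br \<xi> scalar_commutator)
    have "A 0 = 0" "v 0 = 0" "f 0 = 0"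
      using scale[of 0 0] by simp_all
    \<comment> \<open>The identity differs from \<open>A 0\<close> by the scalar 1.\<close>
    then have l_1: "\<xi> (mat 1) = 0" "\<alpha> (mat 1) = 1"
      using lift[of "mat 1" 0 1] sl3_mat_1[OF field_card_3(1)[OF card], of 1] by simp_all
    have app: "(X - mat_scale c (mat 1)) *v u = X *v u - c *s u"
      "u v* (X - mat_scale c (mat 1)) = u v* X - c *s u" for X :: "'k^3^3" and c u
      by (simp_all add: vec_eq_iff forall_3 matrix_vector_mult_def vector_matrix_mult_def
          mat_scale_def mat_def sum_3 algebra_simps)
    show ?thesis
      unfolding psl3_lift_def
      by (simp add: l_add l_scale l_br l_1 add scale br \<xi> app \<open>v 0 = 0\<close> \<open>f 0 = 0\<close>)
  qed
  then show False
    by (rule no_psl3_lift[OF card])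
qed

end
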